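(* Let $A\in\mathbf{R}^{n\times n}$ be an invertible, Schur stable matrix, let $\mathcal{B} = \{b_1,\dots,b_M\}$ be a finite set of vectors in $\mathbf{R}^n$, let $1\le k\le M$, and for each $S\subseteq\mathcal{B}$ let $R_S \succ 0$ be a symmetric input cost matrix of size $|S|\times|S|$. Let $Q \succ 0$ be a symmetric $n\times n$ matrix. Let $$\mathcal{R} = \{R(S) \mid S\subset\mathcal{B},\ |S|\le k\}, \qquad R(S) := B_S R_S^{-1}B_S^T,$$ be the set of all actuator influence matrices for actuator subsets with $k$ or fewer elements, and let $\lambda_1^{max} := \max\{\lambda_1(R)\mid R\in\mathcal{R}\}$. Let $T\in\mathbf{R}^{n\times n}$ be a nonsingular matrix with $\sigma_1(TAT^{-1})<1$ and define $$\alpha_A = \frac{\sigma_1^2(T)}{\sigma_n^2(T)\,(1-\sigma_1^2(TAT^{-1}))}.$$ Then the cost ratio $r(P) = \dfrac{\mathbf{tr}(P_{worst})}{\mathbf{tr}(P_{opt})}$ satisfies $$r(P) \;\leq\; \frac{\alpha_A\,(1+\lambda_1^{max}\lambda_n(Q))\,\mathbf{tr}(Q)}{\sigma_n^2(A)\,\lambda_n(Q) + (1+\lambda_1^{max}\lambda_n(Q))\,\mathbf{tr}(Q)} .$$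
   Context: For $S\subseteq\mathcal{B}$, $B_S\in\mathbf{R}^{n\times|S|}$ is the matrix whose columns are the elements of $S$. The network dynamics are $x_{t+1}=Ax_t+B_Su_t$, and the infinite-horizon linear quadratic regulator cost is $\sum_{t\ge0}(x_t^TQx_t+u_t^TR_Su_t)$. For a given $S$, the optimal cost matrix $P\succeq 0$ is the positive semidefinite solution of the algebraic Riccati equation $$P = Q + A^T P A - A^T P B_S (R_S + B_S^T P B_S)^{-1} B_S^T P A .$$ $P_{opt}$ and $P_{worst}$ denote the solutions of this equation corresponding to the $k$-element subsets $S\subset\mathcal{B}$ that respectively minimize and maximize $\mathbf{tr}(P)$ over all $k$-element subsets. $\lambda_1(\cdot)$ and $\lambda_n(\cdot)$ denote the largest and smallest eigenvalues of a symmetric positive semidefinite $n\times n$ matrix, and $\sigma_1(\cdot)\ge\dots\ge\sigma_n(\cdot)$ are singular values. Schur stable means all eigenvalues have magnitude strictly less than 1. It is a known fact that a square real matrix $A$ is Schur stable if and only if there is a nonsingular $T$ with $\sigma_1(TAT^{-1})<1$. *)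

theory Defs
  imports "Jordan_Normal_Form.Spectral_Radius" "Jordan_Normal_Form.Gauss_Jordan_Elimination"
begin

definition mat_trace :: "real mat \<Rightarrow> real" where
  "mat_trace X = (\<Sum>i<dim_row X. X $$ (i, i))"

(* Intended for invertible square matrices; library lemma mat_inverse identifies the value
   as the two-sided inverse. Otherwise unspecified. *)
definition mat_inv :: "real mat \<Rightarrow> real mat" where
  "mat_inv X = the (mat_inverse X)"

definition symmetric_mat :: "nat \<Rightarrow> real mat \<Rightarrow> bool" where
  "symmetric_mat n X \<longleftrightarrow> X \<in> carrier_mat n n \<and> transpose_mat X = X"

definition pos_semidef :: "nat \<Rightarrow> real mat \<Rightarrow> bool" where
  "pos_semidef n X \<longleftrightarrow> symmetric_mat n X \<and>
     (\<forall>v \<in> carrier_vec n. 0 \<le> scalar_prod v (X *\<^sub>v v))"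

definition pos_def :: "nat \<Rightarrow> real mat \<Rightarrow> bool" where
  "pos_def n X \<longleftrightarrow> symmetric_mat n X \<and>
     (\<forall>v \<in> carrier_vec n. v \<noteq> 0\<^sub>v n \<longrightarrow> 0 < scalar_prod v (X *\<^sub>v v))"

definition schur_stable :: "real mat \<Rightarrow> bool" where
  "schur_stable A \<longleftrightarrow> (\<forall>z \<in> spectrum (map_mat complex_of_real A). cmod z < 1)"

(* Real eigenvalues only; for the symmetric matrices of positive dimension to which these two
   are applied, the set of real eigenvalues is finite and nonempty and contains all eigenvalues. *)
definition lambda_max :: "real mat \<Rightarrow> real" where
  "lambda_max X = Max (spectrum X)"

definition lambda_min :: "real mat \<Rightarrow> real" where
  "lambda_min X = Min (spectrum X)"

(* For square matrices: these are sigma_1 and sigma_n of an n x n matrix. *)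
definition singular_values :: "real mat \<Rightarrow> real set" where
  "singular_values X = sqrt ` spectrum (transpose_mat X * X)"

definition sigma_max :: "real mat \<Rightarrow> real" where
  "sigma_max X = Max (singular_values X)"

definition sigma_min :: "real mat \<Rightarrow> real" where
  "sigma_min X = Min (singular_values X)"

(* The candidate vectors are given as a list bs of distinct vectors, which fixes the order of
   the columns of B_S, and hence of the rows and columns of R_S, for every subset S. *)
definition input_mat :: "nat \<Rightarrow> real vec list \<Rightarrow> real vec set \<Rightarrow> real mat" where
  "input_mat n bs S = mat_of_cols n (filter (\<lambda>b. b \<in> S) bs)"

definition influence_mat ::
  "nat \<Rightarrow> real vec list \<Rightarrow> (real vec set \<Rightarrow> real mat) \<Rightarrow> real vec set \<Rightarrow> real mat" where
  "influence_mat n bs R S =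
     input_mat n bs S * mat_inv (R S) * transpose_mat (input_mat n bs S)"

(* S = {} is admitted; its influence matrix is the zero matrix. *)
definition influence_mats ::
  "nat \<Rightarrow> real vec list \<Rightarrow> (real vec set \<Rightarrow> real mat) \<Rightarrow> nat \<Rightarrow> real mat set" where
  "influence_mats n bs R k = {influence_mat n bs R S |S. S \<subseteq> set bs \<and> card S \<le> k}"

definition lambda_max_influence ::
  "nat \<Rightarrow> real vec list \<Rightarrow> (real vec set \<Rightarrow> real mat) \<Rightarrow> nat \<Rightarrow> real" where
  "lambda_max_influence n bs R k = Max (lambda_max ` influence_mats n bs R k)"

definition riccati_rhs ::
  "real mat \<Rightarrow> real mat \<Rightarrow> real mat \<Rightarrow> real mat \<Rightarrow> real mat \<Rightarrow> real mat" where
  "riccati_rhs A B Q R P =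
     Q + transpose_mat A * P * A
       - transpose_mat A * P * B * mat_inv (R + transpose_mat B * P * B)
           * transpose_mat B * P * A"

definition lqr_cost_mat ::
  "nat \<Rightarrow> real mat \<Rightarrow> real mat \<Rightarrow> real vec list \<Rightarrow> (real vec set \<Rightarrow> real mat)
     \<Rightarrow> real vec set \<Rightarrow> real mat \<Rightarrow> bool" where
  "lqr_cost_mat n A Q bs R S P \<longleftrightarrow>
     pos_semidef n P \<and> P = riccati_rhs A (input_mat n bs S) Q (R S) P"

definition best_cost_mat ::
  "nat \<Rightarrow> real mat \<Rightarrow> real mat \<Rightarrow> real vec list \<Rightarrow> (real vec set \<Rightarrow> real mat)
     \<Rightarrow> nat \<Rightarrow> real mat \<Rightarrow> bool" where
  "best_cost_mat n A Q bs R k P \<longleftrightarrow>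
     (\<exists>S \<subseteq> set bs. card S = k \<and> lqr_cost_mat n A Q bs R S P) \<and>
     (\<forall>S P'. S \<subseteq> set bs \<and> card S = k \<and> lqr_cost_mat n A Q bs R S P'
        \<longrightarrow> mat_trace P \<le> mat_trace P')"

definition worst_cost_mat ::
  "nat \<Rightarrow> real mat \<Rightarrow> real mat \<Rightarrow> real vec list \<Rightarrow> (real vec set \<Rightarrow> real mat)
     \<Rightarrow> nat \<Rightarrow> real mat \<Rightarrow> bool" where
  "worst_cost_mat n A Q bs R k P \<longleftrightarrow>
     (\<exists>S \<subseteq> set bs. card S = k \<and> lqr_cost_mat n A Q bs R S P) \<and>
     (\<forall>S P'. S \<subseteq> set bs \<and> card S = k \<and> lqr_cost_mat n A Q bs R S P'
        \<longrightarrow> mat_trace P' \<le> mat_trace P)"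

definition alpha_const :: "real mat \<Rightarrow> real mat \<Rightarrow> real" where
  "alpha_const A T =
     (sigma_max T)\<^sup>2 / ((sigma_min T)\<^sup>2 * (1 - (sigma_max (T * A * mat_inv T))\<^sup>2))"

end

theory Submission
  imports Defs
begin

text \<open>The Riccati equation implies \<open>P \<le> Q + A\<^sup>T P A\<close>. With \<open>N = (T\<^sup>T T)\<^sup>-\<^sup>1\<close> the contraction
  hypothesis reads \<open>A N A\<^sup>T \<le> s N\<close>, \<open>s = \<sigma>\<^sub>1(T A T\<^sup>-\<^sup>1)\<^sup>2\<close>, so that \<open>tr (P N) \<le> tr (Q N) + s tr (P N)\<close>;
  comparing \<open>N\<close> with multiples of the identity gives \<open>tr P \<le> \<alpha> tr Q\<close>.

  Conversely, completing the square in the Riccati equation gives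
  \<open>x \<bullet> P x = x \<bullet> Q x + d \<bullet> P d + y \<bullet> R y\<close> with \<open>A x = d + B y\<close>. Since \<open>P \<ge> \<lambda> I\<close> for \<open>\<lambda> = \<lambda>\<^sub>n(Q)\<close>, and
  \<open>\<parallel>B y\<parallel>\<^sup>2 \<le> \<rho> (y \<bullet> R y)\<close> whenever \<open>B R\<^sup>-\<^sup>1 B\<^sup>T \<le> \<rho> I\<close>, the last two terms are at least
  \<open>\<lambda> / (1 + \<rho> \<lambda>) \<parallel>A x\<parallel>\<^sup>2\<close>, whence \<open>tr P \<ge> tr Q + \<sigma>\<^sub>n(A)\<^sup>2 \<lambda> / (1 + \<rho> \<lambda>)\<close>.\<close>

section \<open>Real quadratic forms\<close>

lemma scalar_prod_mult_mat_vec_transpose: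
  fixes X :: "real mat"
  assumes "X \<in> carrier_mat nr nc" "x \<in> carrier_vec nr" "y \<in> carrier_vec nc"
  shows "x \<bullet> (X *\<^sub>v y) = (X\<^sup>T *\<^sub>v x) \<bullet> y"
  using transpose_vec_mult_scalar[OF assms(1,3,2)] by simp

lemma scalar_prod_self_nonneg: "0 \<le> v \<bullet> (v :: real vec)"
  unfolding scalar_prod_def by (intro sum_nonneg) simp

lemma scalar_prod_self_eq_0:
  fixes v :: "real vec"
  assumes "v \<in> carrier_vec n" "v \<bullet> v = 0"
  shows "v = 0\<^sub>v n"
proof -
  have "\<forall>i\<in>{0..<dim_vec v}. v $ i * v $ i = 0"
    using assms(2) unfolding scalar_prod_def by (subst (asm) sum_nonneg_eq_0_iff) auto
  then show ?thesis using assms(1) by (intro eq_vecI) auto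
qed

lemma scalar_prod_self_pos:
  fixes v :: "real vec"
  assumes "v \<in> carrier_vec n" "v \<noteq> 0\<^sub>v n"
  shows "0 < v \<bullet> v"
  using scalar_prod_self_nonneg[of v] scalar_prod_self_eq_0[OF assms(1)] assms(2)
  by (metis less_eq_real_def)

text \<open>The value at the vertex \<open>t = - b / c\<close>, multiplied by \<open>c\<close>, is
  \<open>a * c - b\<^sup>2\<close>. Before that, \<open>c < 0\<close> is excluded by a large
  \<open>t\<close>, and for \<open>c = 0\<close> the affine function stays nonnegative only if
  \<open>b = 0\<close>.\<close>

lemma quadratic_nonneg_imp_discriminant:
  fixes a b c :: real
  assumes "\<And>t. 0 \<le> a + 2 * t * b + t\<^sup>2 * c"
  shows "b\<^sup>2 \<le> a * c"
proof (cases "c = 0")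
  case True
  show ?thesis
  proof (cases "b = 0")
    case False
    \<comment> \<open>This \<open>t\<close> is chosen so that the affine function takes the value
      -1.\<close>
    have "0 \<le> a + 2 * (- (a + 1) / (2 * b)) * b"
      using assms[of "- (a + 1) / (2 * b)"] True by simp
    then show ?thesis using False by (simp add: field_simps)
  qed (simp add: True)
next
  case False
  have "0 \<le> c"
  proof (rule ccontr)
    assume "\<not> 0 \<le> c"
    then have c: "c < 0" by simp
    \<comment> \<open>The first summand makes \<open>t * (- c)\<close> exceed the absolute values of
      the other coefficients; the added 1 ensures \<open>1 \<le> t\<close>, so that \<open>a\<close>
      is dominated by \<open>t * \<bar>a\<bar>\<close>.\<close>
    define t where "t = (\<bar>a\<bar> + 2 * \<bar>b\<bar> + 1) / (- c) + 1"
    have t1: "1 \<le> t" unfolding t_def using c by (simp add: divide_nonneg_neg)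
    have tc: "t * (- c) = \<bar>a\<bar> + 2 * \<bar>b\<bar> + 1 - c"
      unfolding t_def using c by (simp add: field_simps)
    have "t\<^sup>2 * c = - (t * (\<bar>a\<bar> + 2 * \<bar>b\<bar> + 1 - c))"
      unfolding tc[symmetric] by (simp add: power2_eq_square)
    then have "a + 2 * t * b + t\<^sup>2 * c = a - t * \<bar>a\<bar> + 2 * t * (b - \<bar>b\<bar>) - t * (1 - c)"
      by (simp add: algebra_simps)
    moreover have "\<bar>a\<bar> \<le> t * \<bar>a\<bar>" using mult_right_mono[OF t1, of "\<bar>a\<bar>"] by simp
    moreover have "2 * t * (b - \<bar>b\<bar>) \<le> 0" using t1 by (simp add: mult_nonneg_nonpos)
    moreover have "0 < t * (1 - c)" using t1 c by simp
    ultimately show False using assms[of t] abs_ge_self[of a] by linarith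
  qed
  then have c: "0 < c" using False by simp
  have "0 \<le> c * (a + 2 * (- b / c) * b + (- b / c)\<^sup>2 * c)"
    using assms[of "- b / c"] c by simp
  also have "\<dots> = a * c - b\<^sup>2"
    using c by (simp add: field_simps power2_eq_square)
  finally show ?thesis by simp
qed

section \<open>Cauchy-Schwarz for semidefinite forms and operator bounds\<close>

lemma symmetric_scalar_prod_comm:
  assumes "symmetric_mat n X" "u \<in> carrier_vec n" "v \<in> carrier_vec n"
  shows "v \<bullet> (X *\<^sub>v u) = u \<bullet> (X *\<^sub>v v)"
proof -
  have X: "X \<in> carrier_mat n n" and sym: "X\<^sup>T = X"
    using assms(1) by (auto simp: symmetric_mat_def)
  have "v \<bullet> (X *\<^sub>v u) = (X *\<^sub>v v) \<bullet> u"
    using scalar_prod_mult_mat_vec_transpose[OF X assms(3,2)] sym by simp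
  also have "\<dots> = u \<bullet> (X *\<^sub>v v)"
    using X assms by (intro comm_scalar_prod[of _ n]) auto
  finally show ?thesis .
qed

lemma quadratic_form_add_smult:
  assumes "symmetric_mat n X" "u \<in> carrier_vec n" "v \<in> carrier_vec n"
  shows "(u + t \<cdot>\<^sub>v v) \<bullet> (X *\<^sub>v (u + t \<cdot>\<^sub>v v)) =
    u \<bullet> (X *\<^sub>v u) + 2 * t * (u \<bullet> (X *\<^sub>v v)) + t\<^sup>2 * (v \<bullet> (X *\<^sub>v v))"
proof -
  have X: "X \<in> carrier_mat n n" using assms(1) by (simp add: symmetric_mat_def)
  have c: "X *\<^sub>v u \<in> carrier_vec n" "X *\<^sub>v v \<in> carrier_vec n" using X assms by auto
  have eq: "X *\<^sub>v (u + t \<cdot>\<^sub>v v) = X *\<^sub>v u + t \<cdot>\<^sub>v (X *\<^sub>v v)"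
    using X assms by (simp add: mult_add_distrib_mat_vec[of _ n n] mult_mat_vec[of _ n n])
  show ?thesis
    unfolding eq
    using assms c symmetric_scalar_prod_comm[OF assms]
    by (simp add: scalar_prod_add_distrib[of _ n] add_scalar_prod_distrib[of _ n]
        power2_eq_square algebra_simps)
qed

text \<open>Along the line \<open>u + t \<cdot>\<^sub>v v\<close> the form is a nonnegative
  quadratic polynomial in \<open>t\<close>, and the claim is its discriminant condition.\<close>

lemma pos_semidef_Cauchy_Schwarz:
  assumes "pos_semidef n X" "u \<in> carrier_vec n" "v \<in> carrier_vec n"
  shows "(u \<bullet> (X *\<^sub>v v))\<^sup>2 \<le> (u \<bullet> (X *\<^sub>v u)) * (v \<bullet> (X *\<^sub>v v))"
proof (rule quadratic_nonneg_imp_discriminant)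
  fix t :: real
  have sym: "symmetric_mat n X" using assms(1) by (simp add: pos_semidef_def)
  have "0 \<le> (u + t \<cdot>\<^sub>v v) \<bullet> (X *\<^sub>v (u + t \<cdot>\<^sub>v v))"
    using assms by (simp add: pos_semidef_def)
  then show "0 \<le> u \<bullet> (X *\<^sub>v u) + 2 * t * (u \<bullet> (X *\<^sub>v v)) + t\<^sup>2 * (v \<bullet> (X *\<^sub>v v))"
    unfolding quadratic_form_add_smult[OF sym assms(2,3)] .
qed

lemma scalar_prod_Cauchy_Schwarz:
  fixes u v :: "real vec"
  assumes "u \<in> carrier_vec n" "v \<in> carrier_vec n"
  shows "(u \<bullet> v)\<^sup>2 \<le> (u \<bullet> u) * (v \<bullet> v)"
proof -
  have "pos_semidef n (1\<^sub>m n)"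
    by (auto simp: pos_semidef_def symmetric_mat_def scalar_prod_self_nonneg)
  from pos_semidef_Cauchy_Schwarz[OF this assms] show ?thesis using assms by simp
qed

text \<open>Cauchy-Schwarz is applied to each row, so the squared Frobenius norm is a bound; adding
  1 keeps the constant positive even for the zero matrix.\<close>

lemma mult_mat_vec_bounded:
  fixes X :: "real mat"
  assumes "X \<in> carrier_mat nr nc"
  obtains c where "0 < c"
    and "\<And>v. v \<in> carrier_vec nc \<Longrightarrow> (X *\<^sub>v v) \<bullet> (X *\<^sub>v v) \<le> c * (v \<bullet> v)"
proof
  let ?c = "(\<Sum>i<nr. row X i \<bullet> row X i) + 1"
  have nn: "0 \<le> (\<Sum>i<nr. row X i \<bullet> row X i)"
    by (intro sum_nonneg scalar_prod_self_nonneg)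
  then show "0 < ?c" by simp
  fix v :: "real vec" assume v: "v \<in> carrier_vec nc"
  have "(X *\<^sub>v v) \<bullet> (X *\<^sub>v v) = (\<Sum>i<nr. (row X i \<bullet> v)\<^sup>2)"
    using assms v by (simp add: scalar_prod_def[of "X *\<^sub>v v"] power2_eq_square atLeast0LessThan)
  also have "\<dots> \<le> (\<Sum>i<nr. (row X i \<bullet> row X i) * (v \<bullet> v))"
    using assms v by (intro sum_mono scalar_prod_Cauchy_Schwarz[of _ nc]) auto
  also have "\<dots> \<le> ?c * (v \<bullet> v)"
    using scalar_prod_self_nonneg[of v] by (simp add: sum_distrib_right[symmetric] distrib_right)
  finally show "(X *\<^sub>v v) \<bullet> (X *\<^sub>v v) \<le> ?c * (v \<bullet> v)" .
qed

text \<open>Cancels the common factor after Cauchy-Schwarz has bounded a squared quantity by itself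
  times the desired bound; the case of a vanishing factor is covered by
  \<open>0 \<le> b\<close>.\<close>

lemma le_of_power2_le_mult:
  fixes a b :: real
  assumes "a\<^sup>2 \<le> a * b" "0 \<le> a" "0 \<le> b"
  shows "a \<le> b"
proof (cases "a = 0")
  case False
  then show ?thesis using assms by (simp add: power2_eq_square)
qed (use assms in simp)

lemma quadratic_form_bounded:
  assumes "X \<in> carrier_mat n n"
  obtains c where "0 < c"
    and "\<And>v. v \<in> carrier_vec n \<Longrightarrow> \<bar>v \<bullet> (X *\<^sub>v v)\<bar> \<le> c * (v \<bullet> (v :: real vec))"
proof -
  obtain c where c: "0 < c"
    and le: "\<And>v. v \<in> carrier_vec n \<Longrightarrow> (X *\<^sub>v v) \<bullet> (X *\<^sub>v v) \<le> c * (v \<bullet> v)"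
    using mult_mat_vec_bounded[OF assms] by blast
  show ?thesis
  proof
    show "0 < c + 1" using c by simp
    fix v :: "real vec" assume v: "v \<in> carrier_vec n"
    note nn = scalar_prod_self_nonneg[of v]
    have "(v \<bullet> (X *\<^sub>v v))\<^sup>2 \<le> (v \<bullet> v) * ((X *\<^sub>v v) \<bullet> (X *\<^sub>v v))"
      using assms v by (intro scalar_prod_Cauchy_Schwarz[of _ n]) auto
    also have "\<dots> \<le> (v \<bullet> v) * (c * (v \<bullet> v))"
      using le[OF v] nn by (rule mult_left_mono)
    also have "\<dots> = c * (v \<bullet> v)\<^sup>2" by (simp add: power2_eq_square)
    \<comment> \<open>Replacing \<open>c\<close> by the larger square \<open>(c + 1)\<^sup>2\<close>
      lets the root be taken without introducing \<open>sqrt c\<close>.\<close>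
    also have "\<dots> \<le> (c + 1)\<^sup>2 * (v \<bullet> v)\<^sup>2"
      using c by (intro mult_right_mono) (auto simp: power2_eq_square algebra_simps)
    also have "\<dots> = ((c + 1) * (v \<bullet> v))\<^sup>2" by (simp add: power_mult_distrib)
    finally have "\<bar>v \<bullet> (X *\<^sub>v v)\<bar> \<le> \<bar>(c + 1) * (v \<bullet> v)\<bar>"
      by (simp add: abs_le_square_iff)
    then show "\<bar>v \<bullet> (X *\<^sub>v v)\<bar> \<le> (c + 1) * (v \<bullet> v)" using c nn by (simp add: abs_mult)
  qed
qed

text \<open>A matrix and its transpose have the same operator norm: for
  \<open>z = X\<^sup>T w\<close> one has \<open>z \<bullet> z = w \<bullet> X z\<close>, and
  Cauchy-Schwarz followed by the bound on \<open>X z\<close> leaves one factor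
  \<open>z \<bullet> z\<close> to cancel.\<close>

lemma transpose_mult_mat_vec_le:
  fixes X :: "real mat"
  assumes "X \<in> carrier_mat nr nc" "0 \<le> c"
    and le: "\<And>v. v \<in> carrier_vec nc \<Longrightarrow> (X *\<^sub>v v) \<bullet> (X *\<^sub>v v) \<le> c * (v \<bullet> v)"
    and w: "w \<in> carrier_vec nr"
  shows "(X\<^sup>T *\<^sub>v w) \<bullet> (X\<^sup>T *\<^sub>v w) \<le> c * (w \<bullet> w)"
proof (rule le_of_power2_le_mult)
  let ?z = "X\<^sup>T *\<^sub>v w"
  have z: "?z \<in> carrier_vec nc" using assms by auto
  have "?z \<bullet> ?z = w \<bullet> (X *\<^sub>v ?z)"
    using scalar_prod_mult_mat_vec_transpose[OF assms(1) w z] by simp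
  then have "(?z \<bullet> ?z)\<^sup>2 \<le> (w \<bullet> w) * ((X *\<^sub>v ?z) \<bullet> (X *\<^sub>v ?z))"
    using scalar_prod_Cauchy_Schwarz[OF w, of "X *\<^sub>v ?z"] assms z by simp
  also have "\<dots> \<le> (w \<bullet> w) * (c * (?z \<bullet> ?z))"
    using le[OF z] scalar_prod_self_nonneg by (intro mult_left_mono)
  finally show "(?z \<bullet> ?z)\<^sup>2 \<le> (?z \<bullet> ?z) * (c * (w \<bullet> w))" by (simp add: algebra_simps)
qed (use assms scalar_prod_self_nonneg in auto)

section \<open>Inverses, nonsingularity and definiteness\<close>

lemma mat_inv_correct:
  assumes X: "X \<in> carrier_mat n n" and det: "det X \<noteq> 0"
  shows "mat_inv X \<in> carrier_mat n n" "X * mat_inv X = 1\<^sub>m n" "mat_inv X * X = 1\<^sub>m n"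
proof -
  obtain Y where "mat_inverse X = Some Y"
    using mat_inverse(1)[OF X, where b = "()"] det_non_zero_imp_unit[OF X det, where b = "()"]
    by (cases "mat_inverse X") auto
  then show "mat_inv X \<in> carrier_mat n n" "X * mat_inv X = 1\<^sub>m n" "mat_inv X * X = 1\<^sub>m n"
    using mat_inverse(2)[OF X] by (auto simp: mat_inv_def)
qed

lemma invertible_mat_det_nonzero:
  fixes X :: "real mat"
  assumes X: "X \<in> carrier_mat n n" and inv: "invertible_mat X"
  shows "det X \<noteq> 0"
proof -
  obtain Y where Y: "X * Y = 1\<^sub>m n" "Y * X = 1\<^sub>m (dim_row Y)"
    using inv X unfolding invertible_mat_def inverts_mat_def by auto
  \<comment> \<open>\<open>invertible_mat\<close> leaves the shape of \<open>Y\<close> open;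
    comparing column counts in the two products determines it.\<close>
  have "dim_row Y = n" "dim_col Y = n"
    using arg_cong[OF Y(2), of dim_col] arg_cong[OF Y(1), of dim_col] X by auto
  then have "Y \<in> carrier_mat n n" by auto
  then have "det X * det Y = 1" using det_mult[OF X, of Y] Y by simp
  then show ?thesis by auto
qed

lemma pos_def_det_nonzero:
  assumes "pos_def n X"
  shows "det X \<noteq> 0"
proof
  assume "det X = 0"
  moreover have X: "X \<in> carrier_mat n n" using assms by (simp add: pos_def_def symmetric_mat_def)
  ultimately obtain v where "v \<in> carrier_vec n" "v \<noteq> 0\<^sub>v n" "X *\<^sub>v v = 0\<^sub>v n"
    using det_0_iff_vec_prod_zero by blast
  then show False using assms by (force simp: pos_def_def)
qed

lemma pos_def_imp_pos_semidef:
  assumes "pos_def n X"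
  shows "pos_semidef n X"
proof -
  have X: "X \<in> carrier_mat n n" using assms by (simp add: pos_def_def symmetric_mat_def)
  have "0 \<le> v \<bullet> (X *\<^sub>v v)" if v: "v \<in> carrier_vec n" for v
    using assms v X by (cases "v = 0\<^sub>v n") (auto simp: pos_def_def less_imp_le)
  then show ?thesis using assms by (auto simp: pos_def_def pos_semidef_def)
qed

lemma smult_mat_mult_vec:
  fixes X :: "real mat"
  assumes "X \<in> carrier_mat nr nc" "v \<in> carrier_vec nc"
  shows "(c \<cdot>\<^sub>m X) *\<^sub>v v = c \<cdot>\<^sub>v (X *\<^sub>v v)"
  using assms by (intro eq_vecI) auto

text \<open>With \<open>w = Y v\<close>, Cauchy-Schwarz for the form \<open>Y\<close> bounds \<open>w \<bullet> w\<close> by a multiple of \<open>v \<bullet> Y v\<close>, and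
  \<open>v = Y\<^sup>-\<^sup>1 w\<close> is bounded by \<open>w\<close>. Hence the largest \<open>m\<close> with \<open>X - m I\<close> semidefinite is an eigenvalue.\<close>

lemma nonsingular_pos_semidef_coercive:
  assumes "pos_semidef n Y" "det Y \<noteq> 0"
  obtains c where "0 < c"
    and "\<And>v. v \<in> carrier_vec n \<Longrightarrow> c * (v \<bullet> v) \<le> v \<bullet> (Y *\<^sub>v v)"
proof -
  have Y: "Y \<in> carrier_mat n n" using assms by (simp add: pos_semidef_def symmetric_mat_def)
  note inv = mat_inv_correct[OF Y assms(2)]
  obtain c where c: "0 < c"
    and cle: "\<And>v. v \<in> carrier_vec n \<Longrightarrow> \<bar>v \<bullet> (Y *\<^sub>v v)\<bar> \<le> c * (v \<bullet> v)"
    using quadratic_form_bounded[OF Y] by blast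
  obtain d where d: "0 < d" and dle:
    "\<And>v. v \<in> carrier_vec n \<Longrightarrow> (mat_inv Y *\<^sub>v v) \<bullet> (mat_inv Y *\<^sub>v v) \<le> d * (v \<bullet> v)"
    using mult_mat_vec_bounded[OF inv(1)] by blast
  show ?thesis
  proof
    show "0 < 1 / (d * c)" using c d by simp
    fix v :: "real vec" assume v: "v \<in> carrier_vec n"
    let ?w = "Y *\<^sub>v v"
    have w: "?w \<in> carrier_vec n" using Y v by auto
    have q: "0 \<le> v \<bullet> ?w" using assms v by (simp add: pos_semidef_def)
    have "?w \<bullet> ?w \<le> c * (v \<bullet> ?w)"
    proof (rule le_of_power2_le_mult)
      have "(?w \<bullet> ?w)\<^sup>2 \<le> (?w \<bullet> (Y *\<^sub>v ?w)) * (v \<bullet> ?w)"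
        using pos_semidef_Cauchy_Schwarz[OF assms(1) w v] .
      also have "\<dots> \<le> (c * (?w \<bullet> ?w)) * (v \<bullet> ?w)"
        using cle[OF w] q by (intro mult_right_mono) auto
      finally show "(?w \<bullet> ?w)\<^sup>2 \<le> (?w \<bullet> ?w) * (c * (v \<bullet> ?w))" by (simp add: algebra_simps)
    qed (use q c scalar_prod_self_nonneg in auto)
    moreover have "mat_inv Y *\<^sub>v ?w = v"
      using assoc_mult_mat_vec[OF inv(1) Y v] inv v by simp
    then have "v \<bullet> v \<le> d * (?w \<bullet> ?w)" using dle[OF w] by simp
    ultimately have "v \<bullet> v \<le> d * (c * (v \<bullet> ?w))"
      using d by (meson mult_left_mono less_imp_le order_trans)
    then show "1 / (d * c) * (v \<bullet> v) \<le> v \<bullet> ?w"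
      using c d by (simp add: field_simps)
  qed
qed

lemma symmetric_least_eigenvalue:
  assumes sym: "symmetric_mat n X" and n: "0 < n"
  obtains m where "m \<in> spectrum X"
    and "\<And>v. v \<in> carrier_vec n \<Longrightarrow> m * (v \<bullet> v) \<le> v \<bullet> (X *\<^sub>v v)"
proof -
  have X: "X \<in> carrier_mat n n" using sym by (simp add: symmetric_mat_def)
  \<comment> \<open>\<open>L\<close> holds the lower bounds of the Rayleigh quotient. It is nonempty
    because the form is bounded, and bounded above by the quotient at a unit vector, which exists
    since \<open>0 < n\<close>. Its supremum \<open>m\<close> is again such a bound.\<close>
  define L where "L = {m. \<forall>v\<in>carrier_vec n. m * (v \<bullet> v) \<le> v \<bullet> (X *\<^sub>v v)}"
  obtain c where "\<And>v. v \<in> carrier_vec n \<Longrightarrow> \<bar>v \<bullet> (X *\<^sub>v v)\<bar> \<le> c * (v \<bullet> v)"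
    using quadratic_form_bounded[OF X] by blast
  then have L_ne: "- c \<in> L" unfolding L_def by (force simp: abs_le_iff)
  have bound: "m \<le> (v \<bullet> (X *\<^sub>v v)) / (v \<bullet> v)"
    if "v \<in> carrier_vec n" "v \<noteq> 0\<^sub>v n" "m \<in> L" for v m
    using that scalar_prod_self_pos[OF that(1,2)] by (auto simp: L_def field_simps)
  have e: "unit_vec n 0 \<in> carrier_vec n" "unit_vec n 0 \<noteq> 0\<^sub>v n" using n by auto
  have bdd: "bdd_above L" using bound[OF e] by (rule bdd_aboveI)
  define m where "m = Sup L"
  have m: "m * (v \<bullet> v) \<le> v \<bullet> (X *\<^sub>v v)" if v: "v \<in> carrier_vec n" for v
  proof (cases "v = 0\<^sub>v n")
    case False
    have "m \<le> (v \<bullet> (X *\<^sub>v v)) / (v \<bullet> v)"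
      unfolding m_def using L_ne bound[OF v False] by (intro cSup_least) auto
    then show ?thesis using scalar_prod_self_pos[OF v False] by (simp add: field_simps)
  qed (use X in simp)
  define Y where "Y = X - m \<cdot>\<^sub>m 1\<^sub>m n"
  have Y: "Y \<in> carrier_mat n n" unfolding Y_def by (rule minus_carrier_mat) simp
  have Yv: "Y *\<^sub>v v = X *\<^sub>v v - m \<cdot>\<^sub>v v" if v: "v \<in> carrier_vec n" for v
    unfolding Y_def using X v by (simp add: minus_mult_distrib_mat_vec[of _ n n] smult_mat_mult_vec[of _ n n])
  have Yq: "v \<bullet> (Y *\<^sub>v v) = v \<bullet> (X *\<^sub>v v) - m * (v \<bullet> v)" if v: "v \<in> carrier_vec n" for v
    using X v by (simp add: Yv scalar_prod_minus_distrib[of _ n])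
  have "Y\<^sup>T = Y"
  proof (rule eq_matI)
    fix i j assume "i < dim_row Y" "j < dim_col Y"
    moreover have "X $$ (j, i) = X $$ (i, j)" if "i < n" "j < n" for i j
      using sym that by (metis X carrier_matD index_transpose_mat(1) symmetric_mat_def)
    ultimately show "Y\<^sup>T $$ (i, j) = Y $$ (i, j)" using X by (auto simp: Y_def)
  qed (use Y in auto)
  then have psd: "pos_semidef n Y" using Y m Yq by (auto simp: pos_semidef_def symmetric_mat_def)
  \<comment> \<open>Were \<open>Y\<close> nonsingular, its coercivity constant \<open>d\<close>
    could be added to \<open>m\<close> without leaving \<open>L\<close>. Hence \<open>Y\<close> has
    a kernel vector, which is an eigenvector of \<open>X\<close> for \<open>m\<close>.\<close>
  have "det Y = 0"
  proof (rule ccontr)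
    assume "det Y \<noteq> 0"
    then obtain d where d: "0 < d"
      and "\<And>v. v \<in> carrier_vec n \<Longrightarrow> d * (v \<bullet> v) \<le> v \<bullet> (Y *\<^sub>v v)"
      using nonsingular_pos_semidef_coercive[OF psd] by blast
    then have "m + d \<in> L" by (simp add: L_def Yq algebra_simps)
    then have "m + d \<le> m" unfolding m_def using bdd by (rule cSup_upper)
    then show False using d by simp
  qed
  then obtain v where v: "v \<in> carrier_vec n" "v \<noteq> 0\<^sub>v n" "Y *\<^sub>v v = 0\<^sub>v n"
    using det_0_iff_vec_prod_zero[OF Y] by blast
  have "X *\<^sub>v v = m \<cdot>\<^sub>v v"
  proof (rule eq_vecI)
    fix i assume "i < dim_vec (m \<cdot>\<^sub>v v)"
    then show "(X *\<^sub>v v) $ i = (m \<cdot>\<^sub>v v) $ i"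
      using arg_cong[OF v(3), of "\<lambda>w. w $ i"] Yv[OF v(1)] v(1) X by simp
  qed (use X v in auto)
  then have "m \<in> spectrum X" using X v by (auto simp: spectrum_def eigenvalue_def eigenvector_def)
  then show ?thesis using m by (rule that)
qed

section \<open>Extremal eigenvalues and singular values\<close>

text \<open>This is the least-eigenvalue result for \<open>- X\<close> with all signs
  reversed.\<close>

lemma symmetric_greatest_eigenvalue:
  assumes sym: "symmetric_mat n X" and n: "0 < n"
  obtains m where "m \<in> spectrum X"
    and "\<And>v. v \<in> carrier_vec n \<Longrightarrow> v \<bullet> (X *\<^sub>v v) \<le> m * (v \<bullet> v)"
proof -
  have X: "X \<in> carrier_mat n n" using sym by (simp add: symmetric_mat_def)
  have "symmetric_mat n (- X)" using sym by (auto simp: symmetric_mat_def transpose_uminus)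
  then obtain m where m: "m \<in> spectrum (- X)"
    and le: "\<And>v. v \<in> carrier_vec n \<Longrightarrow> m * (v \<bullet> v) \<le> v \<bullet> (- X *\<^sub>v v)"
    using symmetric_least_eigenvalue[OF _ n] by blast
  have neg: "- X *\<^sub>v v = - (X *\<^sub>v v)" if "v \<in> carrier_vec n" for v
    using that X by simp
  obtain v where v: "v \<in> carrier_vec n" "v \<noteq> 0\<^sub>v n" "- X *\<^sub>v v = m \<cdot>\<^sub>v v"
    using m X by (auto simp: spectrum_def eigenvalue_def eigenvector_def)
  have "X *\<^sub>v v = - m \<cdot>\<^sub>v v"
  proof (rule eq_vecI)
    fix i assume "i < dim_vec (- m \<cdot>\<^sub>v v)"
    then show "(X *\<^sub>v v) $ i = (- m \<cdot>\<^sub>v v) $ i"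
      using arg_cong[OF v(3), of "\<lambda>w. w $ i"] neg[OF v(1)] v(1) X by simp
  qed (use X v in auto)
  then have "- m \<in> spectrum X" using X v by (auto simp: spectrum_def eigenvalue_def eigenvector_def)
  moreover have "v \<bullet> (X *\<^sub>v v) \<le> - m * (v \<bullet> v)" if v: "v \<in> carrier_vec n" for v
    using le[OF v] neg[OF v] X v by simp
  ultimately show ?thesis by (rule that)
qed

lemma spectrum_symmetric_nonempty:
  assumes "symmetric_mat n X" "0 < n"
  shows "spectrum X \<noteq> {}"
  using symmetric_least_eigenvalue[OF assms] by blast

lemma finite_spectrum_symmetric: "symmetric_mat n X \<Longrightarrow> finite (spectrum X)"
  using card_finite_spectrum(1) by (auto simp: symmetric_mat_def)

lemma lambda_min_le_quadratic_form:
  assumes "symmetric_mat n X" "v \<in> carrier_vec n" "0 < n"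
  shows "lambda_min X * (v \<bullet> v) \<le> v \<bullet> (X *\<^sub>v v)"
proof -
  obtain m where m: "m \<in> spectrum X" and le: "m * (v \<bullet> v) \<le> v \<bullet> (X *\<^sub>v v)"
    using symmetric_least_eigenvalue[OF assms(1,3)] assms(2) by blast
  have "lambda_min X \<le> m"
    unfolding lambda_min_def using finite_spectrum_symmetric[OF assms(1)] m by (rule Min_le)
  then show ?thesis using le scalar_prod_self_nonneg[of v] by (meson mult_right_mono order_trans)
qed

lemma quadratic_form_le_lambda_max:
  assumes "symmetric_mat n X" "v \<in> carrier_vec n" "0 < n"
  shows "v \<bullet> (X *\<^sub>v v) \<le> lambda_max X * (v \<bullet> v)"
proof -
  obtain m where m: "m \<in> spectrum X" and le: "v \<bullet> (X *\<^sub>v v) \<le> m * (v \<bullet> v)"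
    using symmetric_greatest_eigenvalue[OF assms(1,3)] assms(2) by blast
  have "m \<le> lambda_max X"
    unfolding lambda_max_def using finite_spectrum_symmetric[OF assms(1)] m by (rule Max_ge)
  then show ?thesis using le scalar_prod_self_nonneg[of v] by (meson mult_right_mono order_trans)
qed

text \<open>Evaluating the form on an eigenvector transfers the sign of the form to the
  eigenvalue.\<close>

lemma spectrum_quadratic_form:
  assumes "symmetric_mat n X" "m \<in> spectrum X"
  obtains v where "v \<in> carrier_vec n" "v \<noteq> 0\<^sub>v n" "v \<bullet> (X *\<^sub>v v) = m * (v \<bullet> v)"
proof -
  obtain v where "v \<in> carrier_vec n" "v \<noteq> 0\<^sub>v n" "X *\<^sub>v v = m \<cdot>\<^sub>v v"
    using assms by (auto simp: spectrum_def eigenvalue_def eigenvector_def symmetric_mat_def)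
  then show ?thesis using that by simp
qed

lemma pos_semidef_spectrum_nonneg:
  assumes "pos_semidef n X" "m \<in> spectrum X"
  shows "0 \<le> m"
proof -
  obtain v where "v \<in> carrier_vec n" "v \<noteq> 0\<^sub>v n" "v \<bullet> (X *\<^sub>v v) = m * (v \<bullet> v)"
    using spectrum_quadratic_form[of n X m] assms by (auto simp: pos_semidef_def)
  then show ?thesis
    using assms scalar_prod_self_pos[of v n] by (auto simp: pos_semidef_def zero_le_mult_iff)
qed

lemma lambda_min_in_spectrum: "symmetric_mat n X \<Longrightarrow> 0 < n \<Longrightarrow> lambda_min X \<in> spectrum X"
  unfolding lambda_min_def by (intro Min_in finite_spectrum_symmetric spectrum_symmetric_nonempty)

lemma lambda_max_in_spectrum: "symmetric_mat n X \<Longrightarrow> 0 < n \<Longrightarrow> lambda_max X \<in> spectrum X"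
  unfolding lambda_max_def by (intro Max_in finite_spectrum_symmetric spectrum_symmetric_nonempty)

lemma lambda_min_pos:
  assumes "pos_def n X" "0 < n"
  shows "0 < lambda_min X"
proof -
  have sym: "symmetric_mat n X" using assms by (simp add: pos_def_def)
  obtain v where "v \<in> carrier_vec n" "v \<noteq> 0\<^sub>v n" "v \<bullet> (X *\<^sub>v v) = lambda_min X * (v \<bullet> v)"
    using spectrum_quadratic_form[OF sym lambda_min_in_spectrum[OF sym assms(2)]] .
  then show ?thesis
    using assms scalar_prod_self_pos[of v n] by (auto simp: pos_def_def zero_less_mult_iff)
qed

section \<open>Congruence and Gram matrices\<close>

lemma quadratic_form_congruence:
  fixes X :: "real mat"
  assumes "X \<in> carrier_mat m m" "C \<in> carrier_mat m n" "v \<in> carrier_vec n"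
  shows "v \<bullet> ((C\<^sup>T * X * C) *\<^sub>v v) = (C *\<^sub>v v) \<bullet> (X *\<^sub>v (C *\<^sub>v v))"
proof -
  have "(C\<^sup>T * X * C) *\<^sub>v v = C\<^sup>T *\<^sub>v (X *\<^sub>v (C *\<^sub>v v))"
    using assoc_mult_mat_vec[of "C\<^sup>T * X" n m C n v]
      assoc_mult_mat_vec[of "C\<^sup>T" n m X m "C *\<^sub>v v"] assms
    by (simp del: assoc_mult_mat assoc_mult_mat_vec)
  then show ?thesis
    using scalar_prod_mult_mat_vec_transpose[of "C\<^sup>T" n m v "X *\<^sub>v (C *\<^sub>v v)"] assms by simp
qed

lemma symmetric_congruence:
  assumes "symmetric_mat m X" "C \<in> carrier_mat m n"
  shows "symmetric_mat n (C\<^sup>T * X * C)"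
proof -
  have X: "X \<in> carrier_mat m m" "X\<^sup>T = X" using assms by (auto simp: symmetric_mat_def)
  have "(C\<^sup>T * X * C)\<^sup>T = C\<^sup>T * (X\<^sup>T * C\<^sup>T\<^sup>T)"
    using transpose_mult[of "C\<^sup>T * X" n m C n] transpose_mult[of "C\<^sup>T" n m X m] X(1) assms(2)
    by (simp del: assoc_mult_mat)
  also have "\<dots> = C\<^sup>T * X * C"
    using X assms(2) by (simp add: assoc_mult_mat[of _ n m _ m _ n])
  finally show ?thesis
    using X(1) assms(2) mult_carrier_mat[of "C\<^sup>T * X" n m C n] by (simp add: symmetric_mat_def)
qed

lemma pos_semidef_congruence:
  assumes "pos_semidef m X" "C \<in> carrier_mat m n"
  shows "pos_semidef n (C\<^sup>T * X * C)"
  using assms symmetric_congruence[of m X C n] quadratic_form_congruence[of X m C n]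
  by (auto simp: pos_semidef_def symmetric_mat_def)

lemma pos_semidef_one: "pos_semidef n (1\<^sub>m n)"
  by (auto simp: pos_semidef_def symmetric_mat_def scalar_prod_self_nonneg)

lemma pos_semidef_gram:
  assumes "X \<in> carrier_mat m n"
  shows "pos_semidef n (X\<^sup>T * X)"
  using pos_semidef_congruence[OF pos_semidef_one assms] assms by simp

lemma quadratic_form_gram:
  fixes X :: "real mat"
  assumes "X \<in> carrier_mat m n" "v \<in> carrier_vec n"
  shows "v \<bullet> ((X\<^sup>T * X) *\<^sub>v v) = (X *\<^sub>v v) \<bullet> (X *\<^sub>v v)"
proof -
  have "X\<^sup>T * 1\<^sub>m m = X\<^sup>T" "1\<^sub>m m *\<^sub>v (X *\<^sub>v v) = X *\<^sub>v v" using assms by auto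
  then show ?thesis using quadratic_form_congruence[OF one_carrier_mat assms] by simp
qed

section \<open>Singular values as norm bounds\<close>

lemma sigma_max_sq:
  assumes "X \<in> carrier_mat n n" "0 < n"
  shows "0 \<le> sigma_max X" "(sigma_max X)\<^sup>2 = lambda_max (X\<^sup>T * X)"
proof -
  have psd: "pos_semidef n (X\<^sup>T * X)" using pos_semidef_gram[OF assms(1)] .
  then have sym: "symmetric_mat n (X\<^sup>T * X)" by (simp add: pos_semidef_def)
  \<comment> \<open>The square root is monotone and so commutes with the maximum of a finite
    nonempty set; nonnegativity of the Gram spectrum then lets squaring undo it.\<close>
  have "sigma_max X = sqrt (lambda_max (X\<^sup>T * X))"
    unfolding sigma_max_def singular_values_def lambda_max_def
    using finite_spectrum_symmetric[OF sym] spectrum_symmetric_nonempty[OF sym assms(2)]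
    by (intro mono_Max_commute[symmetric]) (auto simp: mono_def)
  moreover have "0 \<le> lambda_max (X\<^sup>T * X)"
    using pos_semidef_spectrum_nonneg[OF psd lambda_max_in_spectrum[OF sym assms(2)]] .
  ultimately show "0 \<le> sigma_max X" "(sigma_max X)\<^sup>2 = lambda_max (X\<^sup>T * X)" by auto
qed

lemma sigma_min_sq:
  assumes "X \<in> carrier_mat n n" "0 < n"
  shows "(sigma_min X)\<^sup>2 = lambda_min (X\<^sup>T * X)"
proof -
  have psd: "pos_semidef n (X\<^sup>T * X)" using pos_semidef_gram[OF assms(1)] .
  then have sym: "symmetric_mat n (X\<^sup>T * X)" by (simp add: pos_semidef_def)
  have "sigma_min X = sqrt (lambda_min (X\<^sup>T * X))"
    unfolding sigma_min_def singular_values_def lambda_min_def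
    using finite_spectrum_symmetric[OF sym] spectrum_symmetric_nonempty[OF sym assms(2)]
    by (intro mono_Min_commute[symmetric]) (auto simp: mono_def)
  moreover have "0 \<le> lambda_min (X\<^sup>T * X)"
    using pos_semidef_spectrum_nonneg[OF psd lambda_min_in_spectrum[OF sym assms(2)]] .
  ultimately show ?thesis by simp
qed

lemma mult_mat_vec_le_sigma_max:
  assumes "X \<in> carrier_mat n n" "v \<in> carrier_vec n" "0 < n"
  shows "(X *\<^sub>v v) \<bullet> (X *\<^sub>v v) \<le> (sigma_max X)\<^sup>2 * (v \<bullet> v)"
  using quadratic_form_le_lambda_max[OF _ assms(2,3), of "X\<^sup>T * X"] pos_semidef_gram[OF assms(1)]
    quadratic_form_gram[OF assms(1,2)] sigma_max_sq[OF assms(1,3)]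
  by (simp add: pos_semidef_def)

lemma sigma_min_le_mult_mat_vec:
  assumes "X \<in> carrier_mat n n" "v \<in> carrier_vec n" "0 < n"
  shows "(sigma_min X)\<^sup>2 * (v \<bullet> v) \<le> (X *\<^sub>v v) \<bullet> (X *\<^sub>v v)"
  using lambda_min_le_quadratic_form[OF _ assms(2,3), of "X\<^sup>T * X"] pos_semidef_gram[OF assms(1)]
    quadratic_form_gram[OF assms(1,2)] sigma_min_sq[OF assms(1,3)]
  by (simp add: pos_semidef_def)

text \<open>A nonsingular matrix has trivial kernel, so its Gram matrix is positive definite. This
  makes it legitimate to divide by \<open>(sigma_min T)\<^sup>2\<close>.\<close>

lemma sigma_min_sq_pos:
  assumes X: "X \<in> carrier_mat n n" and det: "det X \<noteq> 0" and n: "0 < n"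
  shows "0 < (sigma_min X)\<^sup>2"
proof -
  have "0 < v \<bullet> ((X\<^sup>T * X) *\<^sub>v v)" if v: "v \<in> carrier_vec n" "v \<noteq> 0\<^sub>v n" for v
  proof -
    have "X *\<^sub>v v \<noteq> 0\<^sub>v n" using det v det_0_iff_vec_prod_zero[OF X] by blast
    then show ?thesis
      using scalar_prod_self_pos[of "X *\<^sub>v v" n] X v quadratic_form_gram[OF X v(1)] by simp
  qed
  then have "pos_def n (X\<^sup>T * X)"
    using pos_semidef_gram[OF X] by (auto simp: pos_def_def pos_semidef_def)
  then show ?thesis using lambda_min_pos sigma_min_sq[OF X n] n by simp
qed

section \<open>Traces of products of semidefinite matrices\<close>

lemma mat_trace_add:
  assumes "X \<in> carrier_mat n n" "Y \<in> carrier_mat n n"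
  shows "mat_trace (X + Y) = mat_trace X + mat_trace Y"
  using assms by (simp add: mat_trace_def sum.distrib)

lemma mat_trace_minus:
  assumes "X \<in> carrier_mat n n" "Y \<in> carrier_mat n n"
  shows "mat_trace (X - Y) = mat_trace X - mat_trace Y"
  using assms by (simp add: mat_trace_def sum_subtractf)

lemma mat_trace_smult:
  assumes "X \<in> carrier_mat n n"
  shows "mat_trace (c \<cdot>\<^sub>m X) = c * mat_trace X"
  using assms by (simp add: mat_trace_def sum_distrib_left)

lemma mat_trace_mult:
  assumes "X \<in> carrier_mat n m" "Y \<in> carrier_mat m n"
  shows "mat_trace (X * Y) = (\<Sum>i<n. \<Sum>j<m. X $$ (i, j) * Y $$ (j, i))"
  using assms by (simp add: mat_trace_def scalar_prod_def atLeast0LessThan)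

lemma mat_trace_mult_comm:
  assumes "X \<in> carrier_mat n m" "Y \<in> carrier_mat m n"
  shows "mat_trace (X * Y) = mat_trace (Y * X)"
  unfolding mat_trace_mult[OF assms] mat_trace_mult[OF assms(2,1)]
  by (subst sum.swap) (simp add: mult.commute)

lemma quadratic_form_unit_vec:
  fixes X :: "real mat"
  assumes "X \<in> carrier_mat n n" "i < n" "j < n"
  shows "unit_vec n i \<bullet> (X *\<^sub>v unit_vec n j) = X $$ (i, j)"
  using assms by (simp add: scalar_prod_left_unit[of _ n])

lemma mat_trace_quadratic_form:
  assumes "X \<in> carrier_mat n n"
  shows "mat_trace X = (\<Sum>i<n. unit_vec n i \<bullet> (X *\<^sub>v unit_vec n i))"
  using assms by (simp add: mat_trace_def quadratic_form_unit_vec)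

text \<open>\<open>Y\<close> is \<open>X - c q q\<^sup>T\<close>. The three parts supply what one
  Cholesky step needs: symmetry, the changed quadratic form, and the changed trace against
  \<open>M\<close>, since \<open>tr (q q\<^sup>T M) = q \<bullet> M\<^sup>T q\<close>.\<close>

lemma symmetric_mat_minus_rank_one:
  fixes c :: real
  assumes "symmetric_mat n X" "q \<in> carrier_vec n"
  defines "Y \<equiv> mat n n (\<lambda>(i, j). X $$ (i, j) - c * (q $ i * q $ j))"
  shows "symmetric_mat n Y"
    and "v \<in> carrier_vec n \<Longrightarrow> v \<bullet> (Y *\<^sub>v v) = v \<bullet> (X *\<^sub>v v) - c * (v \<bullet> q)\<^sup>2"
    and "M \<in> carrier_mat n n \<Longrightarrow> mat_trace (Y * M) = mat_trace (X * M) - c * (q \<bullet> (M\<^sup>T *\<^sub>v q))"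
proof -
  have X: "X \<in> carrier_mat n n" using assms by (simp add: symmetric_mat_def)
  have "X $$ (j, i) = X $$ (i, j)" if "i < n" "j < n" for i j
    using assms(1) that by (metis X carrier_matD index_transpose_mat(1) symmetric_mat_def)
  then show "symmetric_mat n Y"
    by (auto simp: symmetric_mat_def Y_def intro!: eq_matI)
  define G where "G = mat n n (\<lambda>(i, j). q $ i * q $ j)"
  have G: "G \<in> carrier_mat n n" by (simp add: G_def)
  have Y: "Y = X - c \<cdot>\<^sub>m G" using X by (auto simp: Y_def G_def intro!: eq_matI)
  show "v \<bullet> (Y *\<^sub>v v) = v \<bullet> (X *\<^sub>v v) - c * (v \<bullet> q)\<^sup>2" if v: "v \<in> carrier_vec n"
  proof -
    have "G *\<^sub>v v = (q \<bullet> v) \<cdot>\<^sub>v q"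
      using assms(2) v
      by (intro eq_vecI) (auto simp: G_def scalar_prod_def sum_distrib_left mult_ac)
    then have "Y *\<^sub>v v = X *\<^sub>v v - c \<cdot>\<^sub>v ((q \<bullet> v) \<cdot>\<^sub>v q)"
      unfolding Y using X G v
      by (simp add: minus_mult_distrib_mat_vec[of _ n n] smult_mat_mult_vec[of _ n n])
    then show ?thesis
      using X v assms(2) comm_scalar_prod[OF v assms(2)]
      by (simp add: scalar_prod_minus_distrib[of _ n] power2_eq_square)
  qed
  show "mat_trace (Y * M) = mat_trace (X * M) - c * (q \<bullet> (M\<^sup>T *\<^sub>v q))" if M: "M \<in> carrier_mat n n"
  proof -
    have "mat_trace (G * M) = q \<bullet> (M\<^sup>T *\<^sub>v q)"
      unfolding mat_trace_mult[OF G M] using M assms(2)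
      by (simp add: G_def scalar_prod_def atLeast0LessThan sum_distrib_left mult_ac)
    then show ?thesis
      unfolding Y using X G M
      by (simp add: minus_mult_distrib_mat[of _ n n] mult_smult_assoc_mat[of _ n n]
          mat_trace_minus[of _ n] mat_trace_smult[of _ n])
  qed
qed

text \<open>Induction on the number of nonzero diagonal entries of \<open>X\<close>: a positive diagonal entry is
  removed by a rank-one deflation (a Cholesky step), which keeps \<open>X\<close> semidefinite by
  Cauchy-Schwarz; if the diagonal vanishes, so does \<open>X\<close>.\<close>

lemma mat_trace_mult_pos_semidef_nonneg:
  assumes "pos_semidef n X" and M: "pos_semidef n M"
  shows "0 \<le> mat_trace (X * M)"
  using assms(1)
proof (induction "card {i. i < n \<and> X $$ (i, i) \<noteq> 0}" arbitrary: X rule: less_induct)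
  case less
  have X: "X \<in> carrier_mat n n" and sym: "symmetric_mat n X" and "X\<^sup>T = X"
    using less.prems by (auto simp: pos_semidef_def symmetric_mat_def)
  have Mc: "M \<in> carrier_mat n n" "M\<^sup>T = M" using M by (auto simp: pos_semidef_def symmetric_mat_def)
  have diag: "0 \<le> X $$ (i, i)" if "i < n" for i
  proof -
    have "0 \<le> unit_vec n i \<bullet> (X *\<^sub>v unit_vec n i)"
      using less.prems unit_vec_carrier unfolding pos_semidef_def by blast
    then show ?thesis unfolding quadratic_form_unit_vec[OF X that that] .
  qed
  have CS: "(X $$ (i, j))\<^sup>2 \<le> X $$ (i, i) * X $$ (j, j)" if "i < n" "j < n" for i j
    using pos_semidef_Cauchy_Schwarz[OF less.prems unit_vec_carrier unit_vec_carrier, of i j]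
    unfolding quadratic_form_unit_vec[OF X that] quadratic_form_unit_vec[OF X that(1) that(1)]
      quadratic_form_unit_vec[OF X that(2) that(2)] .
  show ?case
  proof (cases "\<exists>k<n. X $$ (k, k) \<noteq> 0")
    case False
    then have "X $$ (i, j) = 0" if "i < n" "j < n" for i j
      using CS[OF that] that by simp
    then show ?thesis using X Mc by (simp add: mat_trace_mult[of _ n n])
  next
    case True
    then obtain k where k: "k < n" "0 < X $$ (k, k)" using diag order_le_less by metis
    define q where "q = X *\<^sub>v unit_vec n k"
    have q: "q \<in> carrier_vec n" using X by (simp add: q_def)
    have qi: "q $ i = X $$ (i, k)" if "i < n" for i using that X k by (simp add: q_def)
    \<comment> \<open>With \<open>q\<close> the pivot column, this scaling makes
      \<open>c * (q $ k)\<^sup>2\<close> equal to the pivot, so the deflated matrix has a zero in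
      position \<open>(k, k)\<close>.\<close>
    define c where "c = 1 / X $$ (k, k)"
    have c: "0 < c" using k by (simp add: c_def)
    define Y where "Y = mat n n (\<lambda>(i, j). X $$ (i, j) - c * (q $ i * q $ j))"
    note Y = symmetric_mat_minus_rank_one[OF sym q, where c = c, folded Y_def]
    have "0 \<le> v \<bullet> (Y *\<^sub>v v)" if v: "v \<in> carrier_vec n" for v
    proof -
      have "(v \<bullet> q)\<^sup>2 \<le> (v \<bullet> (X *\<^sub>v v)) * X $$ (k, k)"
        using pos_semidef_Cauchy_Schwarz[OF less.prems v unit_vec_carrier, of k]
        unfolding quadratic_form_unit_vec[OF X k(1) k(1)] unfolding q_def .
      then have "c * (v \<bullet> q)\<^sup>2 \<le> c * ((v \<bullet> (X *\<^sub>v v)) * X $$ (k, k))"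
        using c by (intro mult_left_mono) auto
      also have "\<dots> = v \<bullet> (X *\<^sub>v v)" using k by (simp add: c_def)
      finally show ?thesis using Y(2)[OF v] by simp
    qed
    then have Ypsd: "pos_semidef n Y" unfolding pos_semidef_def using Y(1) by blast
    \<comment> \<open>A zero diagonal entry of \<open>X\<close> forces
      \<open>X $$ (i, k) = 0\<close> by Cauchy-Schwarz, so the deflation leaves it zero; since entry
      \<open>k\<close> becomes zero as well, the induction measure drops.\<close>
    have "{i. i < n \<and> Y $$ (i, i) \<noteq> 0} \<subset> {i. i < n \<and> X $$ (i, i) \<noteq> 0}"
    proof
      have "Y $$ (i, i) = 0" if i: "i < n" and zero: "X $$ (i, i) = 0" for i
      proof -
        have "(X $$ (i, k))\<^sup>2 \<le> 0" using CS[OF i k(1)] unfolding zero by simp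
        then show ?thesis using i zero qi[OF i] by (simp add: Y_def)
      qed
      then show "{i. i < n \<and> Y $$ (i, i) \<noteq> 0} \<subseteq> {i. i < n \<and> X $$ (i, i) \<noteq> 0}" by blast
      have "Y $$ (k, k) = 0" using k qi[OF k(1)] by (simp add: Y_def c_def)
      then have "k \<notin> {i. i < n \<and> Y $$ (i, i) \<noteq> 0}" "k \<in> {i. i < n \<and> X $$ (i, i) \<noteq> 0}"
        using k by auto
      then show "{i. i < n \<and> Y $$ (i, i) \<noteq> 0} \<noteq> {i. i < n \<and> X $$ (i, i) \<noteq> 0}"
        by metis
    qed
    then have "card {i. i < n \<and> Y $$ (i, i) \<noteq> 0} < card {i. i < n \<and> X $$ (i, i) \<noteq> 0}"
      by (intro psubset_card_mono) auto
    then have "0 \<le> mat_trace (Y * M)" using less.hyps Ypsd by blast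
    moreover have "0 \<le> c * (q \<bullet> (M *\<^sub>v q))" using c M q by (simp add: pos_semidef_def)
    ultimately show ?thesis using Y(3)[OF Mc(1)] Mc(2) by simp
  qed
qed

lemma quadratic_form_minus:
  assumes "X \<in> carrier_mat n n" "Y \<in> carrier_mat n n" "v \<in> carrier_vec n"
  shows "v \<bullet> ((X - Y) *\<^sub>v v) = v \<bullet> (X *\<^sub>v v) - v \<bullet> (Y *\<^sub>v (v :: real vec))"
  using assms by (simp add: minus_mult_distrib_mat_vec[of _ n n] scalar_prod_minus_distrib[of _ n])

text \<open>The difference \<open>Y - X\<close> is semidefinite, so its product with
  \<open>M\<close> has nonnegative trace: pairing with \<open>M\<close> preserves the Loewner
  order.\<close>

lemma mat_trace_mult_mono:
  assumes "pos_semidef n M" "symmetric_mat n X" "symmetric_mat n Y"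
    and le: "\<And>v. v \<in> carrier_vec n \<Longrightarrow> v \<bullet> (X *\<^sub>v v) \<le> v \<bullet> (Y *\<^sub>v v)"
  shows "mat_trace (M * X) \<le> mat_trace (M * Y)"
proof -
  have c: "M \<in> carrier_mat n n" "X \<in> carrier_mat n n" "Y \<in> carrier_mat n n"
    using assms by (auto simp: pos_semidef_def symmetric_mat_def)
  have "(Y - X)\<^sup>T = Y - X"
    using assms(2,3) transpose_minus[OF c(3,2)] by (simp add: symmetric_mat_def)
  moreover have "v \<bullet> ((Y - X) *\<^sub>v v) = v \<bullet> (Y *\<^sub>v v) - v \<bullet> (X *\<^sub>v v)"
    if "v \<in> carrier_vec n" for v
    using quadratic_form_minus[OF c(3,2) that] .
  ultimately have "pos_semidef n (Y - X)"
    using le c by (auto simp: pos_semidef_def symmetric_mat_def)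
  then have "0 \<le> mat_trace (M * (Y - X))" using mat_trace_mult_pos_semidef_nonneg assms(1) by blast
  then show ?thesis
    using c by (simp add: mult_minus_distrib_mat[of _ n n] mat_trace_minus[of _ n])
qed

lemma symmetric_mat_one: "symmetric_mat n (1\<^sub>m n)"
  by (simp add: symmetric_mat_def)

lemma symmetric_mat_smult:
  assumes "symmetric_mat n X"
  shows "symmetric_mat n (c \<cdot>\<^sub>m X)"
proof -
  have "(c \<cdot>\<^sub>m X)\<^sup>T = c \<cdot>\<^sub>m X\<^sup>T" by (intro eq_matI) auto
  then show ?thesis using assms by (simp add: symmetric_mat_def)
qed

lemma symmetric_mat_add:
  assumes "symmetric_mat n X" "symmetric_mat n Y"
  shows "symmetric_mat n (X + Y)"
  using assms by (auto simp: symmetric_mat_def transpose_add)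

lemma quadratic_form_smult:
  assumes "X \<in> carrier_mat n n" "v \<in> carrier_vec n"
  shows "v \<bullet> ((c \<cdot>\<^sub>m X) *\<^sub>v v) = c * (v \<bullet> (X *\<^sub>v (v :: real vec)))"
  using assms by (simp add: smult_mat_mult_vec[of _ n n])

lemma quadratic_form_add:
  assumes "X \<in> carrier_mat n n" "Y \<in> carrier_mat n n" "v \<in> carrier_vec n"
  shows "v \<bullet> ((X + Y) *\<^sub>v v) = v \<bullet> (X *\<^sub>v v) + v \<bullet> (Y *\<^sub>v (v :: real vec))"
  using assms by (simp add: add_mult_distrib_mat_vec[of _ n n] scalar_prod_add_distrib[of _ n])

text \<open>Pairing the Lyapunov inequality for \<open>P\<close> with a Lyapunov matrix \<open>N\<close> of the transposed
  system avoids the series solution.\<close>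

lemma mat_trace_Lyapunov_le:
  assumes P: "pos_semidef n P" and Q: "pos_semidef n Q" and N: "pos_semidef n N"
    and A: "A \<in> carrier_mat n n" and s: "s < 1" and a: "0 \<le> a"
    and P_le: "\<And>v. v \<in> carrier_vec n \<Longrightarrow>
      v \<bullet> (P *\<^sub>v v) \<le> v \<bullet> (Q *\<^sub>v v) + (A *\<^sub>v v) \<bullet> (P *\<^sub>v (A *\<^sub>v v))"
    and N_contr: "\<And>v. v \<in> carrier_vec n \<Longrightarrow>
      (A\<^sup>T *\<^sub>v v) \<bullet> (N *\<^sub>v (A\<^sup>T *\<^sub>v v)) \<le> s * (v \<bullet> (N *\<^sub>v v))"
    and N_lower: "\<And>v. v \<in> carrier_vec n \<Longrightarrow> v \<bullet> v \<le> a * (v \<bullet> (N *\<^sub>v v))"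
    and N_upper: "\<And>v. v \<in> carrier_vec n \<Longrightarrow> v \<bullet> (N *\<^sub>v v) \<le> b * (v \<bullet> v)"
  shows "mat_trace P \<le> a * b / (1 - s) * mat_trace Q"
proof -
  have syms: "symmetric_mat n P" "symmetric_mat n Q" "symmetric_mat n N"
    using P Q N by (auto simp: pos_semidef_def)
  have c: "P \<in> carrier_mat n n" "Q \<in> carrier_mat n n" "N \<in> carrier_mat n n" "A\<^sup>T \<in> carrier_mat n n"
    using syms A by (auto simp: symmetric_mat_def)
  have PN: "P * N \<in> carrier_mat n n" using c by simp
  have PN_comm: "mat_trace (P * N) = mat_trace (N * P)" using c by (intro mat_trace_mult_comm)
  have APA: "A\<^sup>T * P * A \<in> carrier_mat n n"
    using symmetric_congruence[OF syms(1) A] by (simp add: symmetric_mat_def)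
  have "mat_trace (N * P) \<le> mat_trace (N * (Q + A\<^sup>T * P * A))"
  proof (rule mat_trace_mult_mono[OF N syms(1)])
    show "symmetric_mat n (Q + A\<^sup>T * P * A)"
      using symmetric_mat_add[OF syms(2) symmetric_congruence[OF syms(1) A]] .
    show "v \<bullet> (P *\<^sub>v v) \<le> v \<bullet> ((Q + A\<^sup>T * P * A) *\<^sub>v v)" if v: "v \<in> carrier_vec n" for v
      unfolding quadratic_form_add[OF c(2) APA v] quadratic_form_congruence[OF c(1) A v]
      using P_le[OF v] .
  qed
  also have "\<dots> = mat_trace (N * Q) + mat_trace (N * (A\<^sup>T * P * A))"
    unfolding mult_add_distrib_mat[OF c(3,2) APA]
    using mult_carrier_mat[OF c(3,2)] mult_carrier_mat[OF c(3) APA] by (rule mat_trace_add)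
  also have "mat_trace (N * Q) = mat_trace (Q * N)" using c by (intro mat_trace_mult_comm)
  also have "\<dots> \<le> mat_trace (Q * (b \<cdot>\<^sub>m 1\<^sub>m n))"
    using N_upper by (intro mat_trace_mult_mono[OF Q] syms symmetric_mat_smult symmetric_mat_one)
      (simp add: quadratic_form_smult[of _ n])
  also have "\<dots> = b * mat_trace Q"
    using mult_smult_distrib[OF c(2) one_carrier_mat] c(2) by (simp add: mat_trace_smult[OF c(2)])
  \<comment> \<open>Cyclicity of the trace moves both outer factors onto \<open>N\<close>, where the
    contraction hypothesis \<open>A N A\<^sup>T \<le> s N\<close> applies.\<close>
  also have "mat_trace (N * (A\<^sup>T * P * A)) = mat_trace (P * (A * N * A\<^sup>T))"
    using c A mat_trace_mult_comm[of "N * A\<^sup>T" n n "P * A"]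
    by (simp add: assoc_mult_mat[of _ n n _ n _ n])
  also have "\<dots> \<le> mat_trace (P * (s \<cdot>\<^sub>m N))"
  proof (rule mat_trace_mult_mono[OF P _ symmetric_mat_smult[OF syms(3)]])
    show "symmetric_mat n (A * N * A\<^sup>T)"
      using symmetric_congruence[OF syms(3) c(4)] unfolding transpose_transpose .
    show "v \<bullet> ((A * N * A\<^sup>T) *\<^sub>v v) \<le> v \<bullet> ((s \<cdot>\<^sub>m N) *\<^sub>v v)" if v: "v \<in> carrier_vec n" for v
      using quadratic_form_congruence[OF c(3,4) v] N_contr[OF v]
      unfolding transpose_transpose quadratic_form_smult[OF c(3) v] by (rule ord_eq_le_trans)
  qed
  also have "\<dots> = s * mat_trace (N * P)"
    unfolding mult_smult_distrib[OF c(1,3)] mat_trace_smult[OF PN] PN_comm using c(1) by simp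
  \<comment> \<open>The same trace, with factor \<open>s < 1\<close>, has reappeared on the right
    and is absorbed on the left.\<close>
  finally have "mat_trace (N * P) \<le> b * mat_trace Q / (1 - s)"
    using s by (simp add: field_simps)
  \<comment> \<open>The comparison \<open>I \<le> a N\<close> turns the bound on
    \<open>tr (N P)\<close> back into one on \<open>tr P\<close>.\<close>
  moreover have "mat_trace (P * 1\<^sub>m n) \<le> mat_trace (P * (a \<cdot>\<^sub>m N))"
    using N_lower c by (intro mat_trace_mult_mono[OF P] syms symmetric_mat_smult symmetric_mat_one)
      (simp add: quadratic_form_smult[of _ n])
  then have "mat_trace P \<le> a * mat_trace (N * P)"
    unfolding mult_smult_distrib[OF c(1,3)] mat_trace_smult[OF PN] PN_comm using c(1) by simp
  ultimately have "mat_trace P \<le> a * (b * mat_trace Q / (1 - s))"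
    using a by (meson mult_left_mono order_trans)
  then show ?thesis by simp
qed

section \<open>Riccati equation\<close>

text \<open>With \<open>q = R\<^sup>-\<^sup>1 v\<close> the form of the inverse at \<open>v\<close>
  is the form of \<open>R\<close> at \<open>q\<close>. Symmetry holds because the transposed inverse
  is a left inverse of \<open>R\<close> too.\<close>

lemma mat_inv_pos_def:
  assumes "pos_def m R"
  shows "pos_semidef m (mat_inv R)"
proof -
  have R: "R \<in> carrier_mat m m" and sym: "R\<^sup>T = R"
    using assms by (auto simp: pos_def_def symmetric_mat_def)
  note inv = mat_inv_correct[OF R pos_def_det_nonzero[OF assms]]
  have "(mat_inv R)\<^sup>T * R = 1\<^sub>m m"
    using transpose_mult[OF R inv(1)] inv(2) sym by simp
  then have "(mat_inv R)\<^sup>T = mat_inv R"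
    using assoc_mult_mat[of "(mat_inv R)\<^sup>T" m m R m "mat_inv R" m] R inv by simp
  moreover have "0 \<le> v \<bullet> (mat_inv R *\<^sub>v v)" if v: "v \<in> carrier_vec m" for v
  proof -
    have q: "mat_inv R *\<^sub>v v \<in> carrier_vec m" using inv(1) v by auto
    have "R *\<^sub>v (mat_inv R *\<^sub>v v) = v"
      using assoc_mult_mat_vec[OF R inv(1) v] inv(2) v by simp
    then have "v \<bullet> (mat_inv R *\<^sub>v v) = (mat_inv R *\<^sub>v v) \<bullet> (R *\<^sub>v (mat_inv R *\<^sub>v v))"
      using comm_scalar_prod[OF v q] by simp
    then show ?thesis
      using pos_def_imp_pos_semidef[OF assms] q by (simp add: pos_semidef_def)
  qed
  ultimately show ?thesis using inv(1) by (simp add: pos_semidef_def symmetric_mat_def)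
qed

lemma pos_semidef_influence:
  assumes "pos_def m R" "B \<in> carrier_mat n m"
  shows "pos_semidef n (B * mat_inv R * B\<^sup>T)"
  using pos_semidef_congruence[OF mat_inv_pos_def[OF assms(1)], of "B\<^sup>T" n] assms(2) by simp

text \<open>For \<open>w = B y\<close> and \<open>q = R\<^sup>-\<^sup>1 B\<^sup>T w\<close> one has
  \<open>w \<bullet> w = y \<bullet> R q\<close>, while \<open>q \<bullet> R q\<close> is the
  influence form at \<open>w\<close>. Cauchy-Schwarz in the \<open>R\<close> form gives the bound
  without a square root of \<open>R\<close>.\<close>

lemma input_norm_le_input_cost:
  assumes R: "pos_def m R" and B: "B \<in> carrier_mat n m" and r: "0 \<le> r"
    and influence: "\<And>w. w \<in> carrier_vec n \<Longrightarrow> w \<bullet> ((B * mat_inv R * B\<^sup>T) *\<^sub>v w) \<le> r * (w \<bullet> w)"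
    and y: "y \<in> carrier_vec m"
  shows "(B *\<^sub>v y) \<bullet> (B *\<^sub>v y) \<le> r * (y \<bullet> (R *\<^sub>v y))"
proof (rule le_of_power2_le_mult)
  have Rc: "R \<in> carrier_mat m m" and psd: "pos_semidef m R"
    using R pos_def_imp_pos_semidef by (auto simp: pos_def_def symmetric_mat_def)
  note inv = mat_inv_correct[OF Rc pos_def_det_nonzero[OF R]]
  define w where "w = B *\<^sub>v y"
  have w: "w \<in> carrier_vec n" using B y by (simp add: w_def)
  have Bw: "B\<^sup>T *\<^sub>v w \<in> carrier_vec m" using B w by simp
  define q where "q = mat_inv R *\<^sub>v (B\<^sup>T *\<^sub>v w)"
  have q: "q \<in> carrier_vec m" using inv(1) Bw by (simp add: q_def)
  have Rq: "R *\<^sub>v q = B\<^sup>T *\<^sub>v w"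
    unfolding q_def using assoc_mult_mat_vec[OF Rc inv(1) Bw] inv(2) Bw by simp
  have "w \<bullet> w = y \<bullet> (R *\<^sub>v q)"
    using scalar_prod_mult_mat_vec_transpose[OF B w y] comm_scalar_prod[OF y Bw]
    by (simp add: w_def[symmetric] Rq)
  then have "(w \<bullet> w)\<^sup>2 \<le> (y \<bullet> (R *\<^sub>v y)) * (q \<bullet> (R *\<^sub>v q))"
    using pos_semidef_Cauchy_Schwarz[OF psd y q] by simp
  also have "q \<bullet> (R *\<^sub>v q) = w \<bullet> ((B * mat_inv R * B\<^sup>T) *\<^sub>v w)"
    using quadratic_form_congruence[of "mat_inv R" m "B\<^sup>T" n w] inv(1) B w comm_scalar_prod[OF q Bw]
    by (simp add: Rq q_def[symmetric])
  also have "(y \<bullet> (R *\<^sub>v y)) * \<dots> \<le> (y \<bullet> (R *\<^sub>v y)) * (r * (w \<bullet> w))"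
    using influence[OF w] psd y by (intro mult_left_mono) (auto simp: pos_semidef_def)
  finally show "((B *\<^sub>v y) \<bullet> (B *\<^sub>v y))\<^sup>2 \<le> (B *\<^sub>v y) \<bullet> (B *\<^sub>v y) * (r * (y \<bullet> (R *\<^sub>v y)))"
    by (simp add: w_def mult_ac)
  show "0 \<le> r * (y \<bullet> (R *\<^sub>v y))" using r psd y by (simp add: pos_semidef_def)
qed (rule scalar_prod_self_nonneg)

text \<open>Positive definiteness guarantees that \<open>mat_inv\<close> in
  \<open>riccati_rhs\<close> denotes a genuine inverse.\<close>

lemma pos_def_input_cost:
  assumes P: "pos_semidef n P" and R: "pos_def m R" and B: "B \<in> carrier_mat n m"
  shows "pos_def m (R + B\<^sup>T * P * B)"
    and "y \<in> carrier_vec m \<Longrightarrow>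
      y \<bullet> ((R + B\<^sup>T * P * B) *\<^sub>v y) = y \<bullet> (R *\<^sub>v y) + (B *\<^sub>v y) \<bullet> (P *\<^sub>v (B *\<^sub>v y))"
proof -
  have syms: "symmetric_mat m R" "symmetric_mat n P" "symmetric_mat m (B\<^sup>T * P * B)"
    using P R symmetric_congruence[of n P B m] B by (auto simp: pos_semidef_def pos_def_def)
  then have c: "R \<in> carrier_mat m m" "P \<in> carrier_mat n n" "B\<^sup>T * P * B \<in> carrier_mat m m"
    by (auto simp: symmetric_mat_def)
  show form: "y \<bullet> ((R + B\<^sup>T * P * B) *\<^sub>v y) = y \<bullet> (R *\<^sub>v y) + (B *\<^sub>v y) \<bullet> (P *\<^sub>v (B *\<^sub>v y))"
    if "y \<in> carrier_vec m" for y
    unfolding quadratic_form_add[OF c(1,3) that] quadratic_form_congruence[OF c(2) B that] ..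
  have "0 \<le> (B *\<^sub>v y) \<bullet> (P *\<^sub>v (B *\<^sub>v y))" if "y \<in> carrier_vec m" for y
    using P B that by (simp add: pos_semidef_def)
  then show "pos_def m (R + B\<^sup>T * P * B)"
    using symmetric_mat_add[OF syms(1,3)] R form by (force simp: pos_def_def intro: add_pos_nonneg)
qed

text \<open>Completion of squares: the feedback \<open>y\<close> turns the Riccati map into closed-loop cost plus
  input cost.\<close>

lemma riccati_rhs_quadratic_form:
  assumes A: "A \<in> carrier_mat n n" and Q: "Q \<in> carrier_mat n n" and P: "pos_semidef n P"
    and R: "pos_def m R" and B: "B \<in> carrier_mat n m" and x: "x \<in> carrier_vec n"
  obtains y d where "y \<in> carrier_vec m" "d \<in> carrier_vec n" "A *\<^sub>v x = d + B *\<^sub>v y"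
    and "x \<bullet> (riccati_rhs A B Q R P *\<^sub>v x) = x \<bullet> (Q *\<^sub>v x) + d \<bullet> (P *\<^sub>v d) + y \<bullet> (R *\<^sub>v y)"
    and "x \<bullet> (riccati_rhs A B Q R P *\<^sub>v x) \<le> x \<bullet> (Q *\<^sub>v x) + (A *\<^sub>v x) \<bullet> (P *\<^sub>v (A *\<^sub>v x))"
proof -
  have Pc: "P \<in> carrier_mat n n" and sym: "symmetric_mat n P" and PT: "P\<^sup>T = P"
    using P by (auto simp: pos_semidef_def symmetric_mat_def)
  have Rc: "R \<in> carrier_mat m m" using R by (simp add: pos_def_def symmetric_mat_def)
  define Z where "Z = R + B\<^sup>T * P * B"
  have Z: "pos_def m Z" and Zform: "\<And>y. y \<in> carrier_vec m \<Longrightarrow>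
      y \<bullet> (Z *\<^sub>v y) = y \<bullet> (R *\<^sub>v y) + (B *\<^sub>v y) \<bullet> (P *\<^sub>v (B *\<^sub>v y))"
    using pos_def_input_cost[OF P R B] by (auto simp: Z_def)
  have Zc: "Z \<in> carrier_mat m m" using Z by (simp add: pos_def_def symmetric_mat_def)
  note inv = mat_inv_correct[OF Zc pos_def_det_nonzero[OF Z]]
  define v where "v = A *\<^sub>v x"
  have v: "v \<in> carrier_vec n" using A x by (simp add: v_def)
  have Pv: "P *\<^sub>v v \<in> carrier_vec n" using Pc v by simp
  define c where "c = B\<^sup>T *\<^sub>v (P *\<^sub>v v)"
  have c: "c \<in> carrier_vec m" using B Pv by (simp add: c_def)
  \<comment> \<open>Up to sign, \<open>y\<close> is the optimal input at state \<open>x\<close>, and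
    \<open>d = A x - B y\<close> below is the resulting next state.\<close>
  define y where "y = mat_inv Z *\<^sub>v c"
  have y: "y \<in> carrier_vec m" using inv(1) c by (simp add: y_def)
  have Zy: "Z *\<^sub>v y = c"
    unfolding y_def using assoc_mult_mat_vec[OF Zc inv(1) c] inv(2) c by simp
  have By: "B *\<^sub>v y \<in> carrier_vec n" using B y by simp
  define d where "d = v + (- 1) \<cdot>\<^sub>v (B *\<^sub>v y)"
  have d: "d \<in> carrier_vec n" using v By by (simp add: d_def)
  have AT: "A\<^sup>T \<in> carrier_mat n n" and BT: "B\<^sup>T \<in> carrier_mat m n" using A B by auto
  define K where "K = A\<^sup>T * P * B * mat_inv Z * B\<^sup>T * P * A"
  have k1: "A\<^sup>T * P \<in> carrier_mat n n" using AT Pc by (rule mult_carrier_mat)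
  have k2: "A\<^sup>T * P * B \<in> carrier_mat n m" using k1 B by (rule mult_carrier_mat)
  have k3: "A\<^sup>T * P * B * mat_inv Z \<in> carrier_mat n m" using k2 inv(1) by (rule mult_carrier_mat)
  have k4: "A\<^sup>T * P * B * mat_inv Z * B\<^sup>T \<in> carrier_mat n n" using k3 BT by (rule mult_carrier_mat)
  have k5: "A\<^sup>T * P * B * mat_inv Z * B\<^sup>T * P \<in> carrier_mat n n"
    using k4 Pc by (rule mult_carrier_mat)
  have K: "K \<in> carrier_mat n n" unfolding K_def using k5 A by (rule mult_carrier_mat)
  have "K *\<^sub>v x = A\<^sup>T *\<^sub>v (P *\<^sub>v (B *\<^sub>v y))"
    unfolding K_def y_def
      assoc_mult_mat_vec[OF k5 A x] v_def[symmetric] assoc_mult_mat_vec[OF k4 Pc v]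
      assoc_mult_mat_vec[OF k3 BT Pv] c_def[symmetric] assoc_mult_mat_vec[OF k2 inv(1) c]
    unfolding y_def[symmetric] assoc_mult_mat_vec[OF k1 B y] assoc_mult_mat_vec[OF AT Pc By] ..
  then have "x \<bullet> (K *\<^sub>v x) = v \<bullet> (P *\<^sub>v (B *\<^sub>v y))"
    using scalar_prod_mult_mat_vec_transpose[OF AT x, of "P *\<^sub>v (B *\<^sub>v y)"] Pc By
    by (simp add: v_def)
  \<comment> \<open>Since \<open>Z y = B\<^sup>T P v\<close>, the cross term of the square coincides
    with \<open>y \<bullet> Z y\<close>, which is also the subtracted term of the Riccati
    map.\<close>
  moreover have vPBy: "v \<bullet> (P *\<^sub>v (B *\<^sub>v y)) = y \<bullet> (Z *\<^sub>v y)"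
    using scalar_prod_mult_mat_vec_transpose[OF Pc v By] PT
      scalar_prod_mult_mat_vec_transpose[OF B Pv y] comm_scalar_prod[OF y c]
    by (simp add: Zy c_def)
  moreover have "riccati_rhs A B Q R P = Q + A\<^sup>T * P * A - K"
    by (simp only: riccati_rhs_def K_def Z_def)
  moreover have APA: "A\<^sup>T * P * A \<in> carrier_mat n n" using k1 A by (rule mult_carrier_mat)
  ultimately have form: "x \<bullet> (riccati_rhs A B Q R P *\<^sub>v x) =
      x \<bullet> (Q *\<^sub>v x) + v \<bullet> (P *\<^sub>v v) - y \<bullet> (Z *\<^sub>v y)"
    using quadratic_form_minus[OF add_carrier_mat[OF APA] K x] quadratic_form_add[OF Q APA x]
      quadratic_form_congruence[OF Pc A x]
    by (simp only: v_def[symmetric])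
  \<comment> \<open>The expansion at \<open>t = - 1\<close> gives \<open>v \<bullet> P v - 2 (y
    \<bullet> Z y) + (B y) \<bullet> P (B y)\<close>, and the last term is
    \<open>y \<bullet> Z y - y \<bullet> R y\<close>.\<close>
  have "d \<bullet> (P *\<^sub>v d) = v \<bullet> (P *\<^sub>v v) - y \<bullet> (Z *\<^sub>v y) - y \<bullet> (R *\<^sub>v y)"
    unfolding d_def quadratic_form_add_smult[OF sym v By] vPBy using Zform[OF y] by simp
  moreover have "v = d + B *\<^sub>v y"
    unfolding d_def using v B By by (intro eq_vecI) auto
  moreover have "0 \<le> y \<bullet> (Z *\<^sub>v y)"
    using pos_def_imp_pos_semidef[OF Z] y by (simp add: pos_semidef_def)
  ultimately show ?thesis
    using that[OF y d] form by (simp add: v_def[symmetric])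
qed

section \<open>Trace bounds for solutions of the Riccati equation\<close>

lemma weighted_norm_add_le:
  fixes d w :: "real vec"
  assumes d: "d \<in> carrier_vec n" and w: "w \<in> carrier_vec n"
    and "0 \<le> l" "0 \<le> r" "0 \<le> t" and wr: "w \<bullet> w \<le> r * t"
  shows "l * ((d + w) \<bullet> (d + w)) \<le> (1 + r * l) * (l * (d \<bullet> d) + t)"
proof -
  have dd: "0 \<le> d \<bullet> d" by (rule scalar_prod_self_nonneg)
  have add: "(d + w) \<bullet> (d + w) = d \<bullet> d + 2 * (d \<bullet> w) + w \<bullet> w"
    using d w comm_scalar_prod[OF d w]
    by (simp add: scalar_prod_add_distrib[of _ n] add_scalar_prod_distrib[of _ n])
  \<comment> \<open>\<open>a\<close> is the weight that balances the cross term: its square is at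
    most \<open>4 * a * t\<close>, so it is at most \<open>a + t\<close> by the arithmetic-geometric
    mean inequality, and \<open>a\<close> is exactly one of the products in the expanded right-hand
    side.\<close>
  define a where "a = r * l\<^sup>2 * (d \<bullet> d)"
  have a: "0 \<le> a" using assms dd by (simp add: a_def)
  have "(2 * (l * (d \<bullet> w)))\<^sup>2 = 4 * (l\<^sup>2 * (d \<bullet> w)\<^sup>2)"
    by (simp add: power_mult_distrib)
  also have "\<dots> \<le> 4 * (l\<^sup>2 * ((d \<bullet> d) * (w \<bullet> w)))"
    using scalar_prod_Cauchy_Schwarz[OF d w] by (intro mult_left_mono) auto
  also have "\<dots> \<le> 4 * (l\<^sup>2 * ((d \<bullet> d) * (r * t)))"
    using wr dd by (intro mult_left_mono) auto
  also have "\<dots> = 4 * a * t" by (simp add: a_def)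
  also have "\<dots> \<le> (a + t)\<^sup>2"
    using zero_le_power2[of "a - t"] by (simp add: power2_eq_square algebra_simps)
  finally have "2 * (l * (d \<bullet> w)) \<le> a + t"
    by (rule power2_le_imp_le) (use a \<open>0 \<le> t\<close> in simp)
  moreover have "l * (w \<bullet> w) \<le> l * (r * t)" using wr \<open>0 \<le> l\<close> by (rule mult_left_mono)
  moreover have "l * (d \<bullet> d + 2 * (d \<bullet> w) + w \<bullet> w)
      = l * (d \<bullet> d) + 2 * (l * (d \<bullet> w)) + l * (w \<bullet> w)"
    by (simp add: distrib_left)
  moreover have "(1 + r * l) * (l * (d \<bullet> d) + t) = l * (d \<bullet> d) + t + a + l * (r * t)"
    by (simp add: a_def power2_eq_square distrib_left distrib_right)
  ultimately show ?thesis unfolding add by linarith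
qed

text \<open>The completed square is used twice: dropping its last two terms gives
  \<open>P \<ge> Q\<close>, hence \<open>P \<ge> l I\<close>; applying this bound to
  \<open>d\<close> in the second use retains a definite share of the squared norm of
  \<open>A x\<close>.\<close>

lemma riccati_cost_trace_lower:
  assumes n: "0 < n" and A: "A \<in> carrier_mat n n" and Q: "pos_def n Q" and P: "pos_semidef n P"
    and R: "pos_def m R" and B: "B \<in> carrier_mat n m" and r: "0 \<le> r"
    and influence: "\<And>w. w \<in> carrier_vec n \<Longrightarrow> w \<bullet> ((B * mat_inv R * B\<^sup>T) *\<^sub>v w) \<le> r * (w \<bullet> w)"
    and riccati: "P = riccati_rhs A B Q R P"
  shows "mat_trace Q + (sigma_min A)\<^sup>2 * lambda_min Q / (1 + r * lambda_min Q) \<le> mat_trace P"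
proof -
  have Qc: "Q \<in> carrier_mat n n" and Qsym: "symmetric_mat n Q" and Pc: "P \<in> carrier_mat n n"
    using Q P by (auto simp: pos_def_def pos_semidef_def symmetric_mat_def)
  define l where "l = lambda_min Q"
  have l: "0 < l" using lambda_min_pos[OF Q n] by (simp add: l_def)
  have rl: "0 < 1 + r * l" using r l by (simp add: add_pos_nonneg)
  have R_nonneg: "0 \<le> y \<bullet> (R *\<^sub>v y)" if "y \<in> carrier_vec m" for y
    using pos_def_imp_pos_semidef[OF R] that by (simp add: pos_semidef_def)
  have Ple: "l * (x \<bullet> x) \<le> x \<bullet> (P *\<^sub>v x)" if x: "x \<in> carrier_vec n" for x
  proof -
    obtain y d where yd: "y \<in> carrier_vec m" "d \<in> carrier_vec n"
      "x \<bullet> (riccati_rhs A B Q R P *\<^sub>v x) = x \<bullet> (Q *\<^sub>v x) + d \<bullet> (P *\<^sub>v d) + y \<bullet> (R *\<^sub>v y)"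
      by (rule riccati_rhs_quadratic_form[OF A Qc P R B x])
    then have "x \<bullet> (Q *\<^sub>v x) \<le> x \<bullet> (P *\<^sub>v x)"
      using P R_nonneg unfolding riccati[symmetric] by (simp add: pos_semidef_def)
    then show ?thesis using lambda_min_le_quadratic_form[OF Qsym x n] by (simp add: l_def)
  qed
  have step: "x \<bullet> (Q *\<^sub>v x) + (sigma_min A)\<^sup>2 * l / (1 + r * l) * (x \<bullet> x) \<le> x \<bullet> (P *\<^sub>v x)"
    if x: "x \<in> carrier_vec n" for x
  proof -
    obtain y d where y: "y \<in> carrier_vec m" and d: "d \<in> carrier_vec n" and Ax: "A *\<^sub>v x = d + B *\<^sub>v y"
      and form: "x \<bullet> (riccati_rhs A B Q R P *\<^sub>v x)
        = x \<bullet> (Q *\<^sub>v x) + d \<bullet> (P *\<^sub>v d) + y \<bullet> (R *\<^sub>v y)"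
      by (rule riccati_rhs_quadratic_form[OF A Qc P R B x])
    have By: "B *\<^sub>v y \<in> carrier_vec n" using B y by simp
    have "l * ((sigma_min A)\<^sup>2 * (x \<bullet> x)) \<le> l * ((d + B *\<^sub>v y) \<bullet> (d + B *\<^sub>v y))"
      using sigma_min_le_mult_mat_vec[OF A x n] l by (simp add: Ax)
    also have "\<dots> \<le> (1 + r * l) * (l * (d \<bullet> d) + y \<bullet> (R *\<^sub>v y))"
      using l r R_nonneg[OF y] input_norm_le_input_cost[OF R B r influence y]
      by (intro weighted_norm_add_le[OF d By]) auto
    also have "\<dots> \<le> (1 + r * l) * (d \<bullet> (P *\<^sub>v d) + y \<bullet> (R *\<^sub>v y))"
      using Ple[OF d] rl by simp
    finally have "(sigma_min A)\<^sup>2 * l / (1 + r * l) * (x \<bullet> x) \<le> d \<bullet> (P *\<^sub>v d) + y \<bullet> (R *\<^sub>v y)"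
      using rl by (simp add: pos_divide_le_eq mult_ac)
    then show ?thesis using form unfolding riccati[symmetric] by simp
  qed
  define g where "g = (sigma_min A)\<^sup>2 * l / (1 + r * l)"
  have "0 \<le> g" using l rl by (simp add: g_def)
  \<comment> \<open>Summing over the unit vectors yields \<open>n\<close> copies of
    \<open>g\<close>, of which one is kept.\<close>
  then have "g \<le> (\<Sum>i<n. g)" using n by (simp add: mult_le_cancel_right1)
  then have "mat_trace Q + g \<le> (\<Sum>i<n. unit_vec n i \<bullet> (Q *\<^sub>v unit_vec n i) + g)"
    unfolding mat_trace_quadratic_form[OF Qc] sum.distrib by simp
  also have "\<dots> \<le> mat_trace P"
    unfolding mat_trace_quadratic_form[OF Pc]
  proof (rule sum_mono)
    fix i assume "i \<in> {..<n}"
    then show "unit_vec n i \<bullet> (Q *\<^sub>v unit_vec n i) + g \<le> unit_vec n i \<bullet> (P *\<^sub>v unit_vec n i)"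
      using step[of "unit_vec n i"] by (simp add: g_def)
  qed
  finally show ?thesis by (simp add: g_def l_def)
qed

lemma riccati_cost_trace_upper:
  assumes n: "0 < n" and A: "A \<in> carrier_mat n n" and Q: "pos_semidef n Q" and P: "pos_semidef n P"
    and R: "pos_def m R" and B: "B \<in> carrier_mat n m"
    and riccati: "P = riccati_rhs A B Q R P"
    and T: "T \<in> carrier_mat n n" "det T \<noteq> 0" and contr: "sigma_max (T * A * mat_inv T) < 1"
  shows "mat_trace P \<le> alpha_const A T * mat_trace Q"
proof -
  have Qc: "Q \<in> carrier_mat n n" using Q by (simp add: pos_semidef_def symmetric_mat_def)
  define U where "U = mat_inv T"
  have U: "U \<in> carrier_mat n n" "T * U = 1\<^sub>m n" "U * T = 1\<^sub>m n"
    using mat_inv_correct[OF T] by (auto simp: U_def)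
  define C where "C = T * A * U"
  have C: "C \<in> carrier_mat n n" using T A U by (simp add: C_def)
  \<comment> \<open>The intertwining relation \<open>U C = A U\<close>, once transposed, lets
    \<open>U\<^sup>T\<close> carry the action of \<open>A\<^sup>T\<close> to that of
    \<open>C\<^sup>T\<close>, so the contraction of \<open>C\<close> becomes one in the
    \<open>N\<close> form.\<close>
  have "U * C = U * T * (A * U)"
    unfolding C_def using T(1) A U(1) by (simp add: assoc_mult_mat[of _ n n _ n _ n])
  then have UC: "U * C = A * U" unfolding U(3) using A U by simp
  define N where "N = U * U\<^sup>T"
  have UT: "U\<^sup>T \<in> carrier_mat n n" using U by simp
  have N: "pos_semidef n N" using pos_semidef_gram[OF UT] by (simp add: N_def)
  have Nform: "w \<bullet> (N *\<^sub>v w) = (U\<^sup>T *\<^sub>v w) \<bullet> (U\<^sup>T *\<^sub>v w)" if "w \<in> carrier_vec n" for w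
    using quadratic_form_gram[OF UT that] by (simp add: N_def)
  define s where "s = (sigma_max C)\<^sup>2"
  have s: "s < 1"
    using sigma_max_sq(1)[OF C n] contr by (simp add: s_def C_def U_def power_less_one_iff)
  \<comment> \<open>The Lyapunov bound is taken with \<open>a = (sigma_max T)\<^sup>2\<close> and
    \<open>b = 1 / (sigma_min T)\<^sup>2\<close>, so that \<open>a * b / (1 - s)\<close> is
    \<open>alpha_const A T\<close>.\<close>
  have "mat_trace P \<le>
      (sigma_max T)\<^sup>2 * (1 / (sigma_min T)\<^sup>2) / (1 - s) * mat_trace Q"
  proof (rule mat_trace_Lyapunov_le[OF P Q N A s])
    fix v :: "real vec" assume v: "v \<in> carrier_vec n"
    have Uv: "U\<^sup>T *\<^sub>v v \<in> carrier_vec n" using U v by simp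
    show "v \<bullet> (P *\<^sub>v v) \<le> v \<bullet> (Q *\<^sub>v v) + (A *\<^sub>v v) \<bullet> (P *\<^sub>v (A *\<^sub>v v))"
      using riccati_rhs_quadratic_form[OF A Qc P R B v] unfolding riccati[symmetric] by blast
    have "U\<^sup>T *\<^sub>v (A\<^sup>T *\<^sub>v v) = (U\<^sup>T * A\<^sup>T) *\<^sub>v v"
      using U A v assoc_mult_mat_vec[of "U\<^sup>T" n n "A\<^sup>T" n v] by simp
    also have "U\<^sup>T * A\<^sup>T = C\<^sup>T * U\<^sup>T"
      using transpose_mult[OF A U(1)] transpose_mult[OF U(1) C] UC by simp
    also have "\<dots> *\<^sub>v v = C\<^sup>T *\<^sub>v (U\<^sup>T *\<^sub>v v)"
      using U C v assoc_mult_mat_vec[of "C\<^sup>T" n n "U\<^sup>T" n v] by simp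
    finally show "(A\<^sup>T *\<^sub>v v) \<bullet> (N *\<^sub>v (A\<^sup>T *\<^sub>v v)) \<le> s * (v \<bullet> (N *\<^sub>v v))"
      using Nform[of "A\<^sup>T *\<^sub>v v"] Nform[OF v] A v
        transpose_mult_mat_vec_le[OF C _ mult_mat_vec_le_sigma_max[OF C _ n] Uv]
      by (simp add: s_def)
    \<comment> \<open>\<open>T\<^sup>T\<close> recovers \<open>v\<close> from
      \<open>U\<^sup>T v\<close>, whose squared norm is the \<open>N\<close> form at
      \<open>v\<close>.\<close>
    have "T\<^sup>T *\<^sub>v (U\<^sup>T *\<^sub>v v) = (T\<^sup>T * U\<^sup>T) *\<^sub>v v"
      using U T v assoc_mult_mat_vec[of "T\<^sup>T" n n "U\<^sup>T" n v] by simp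
    also have "T\<^sup>T * U\<^sup>T = 1\<^sub>m n"
      using transpose_mult[OF U(1) T(1)] U(3) by simp
    finally show "v \<bullet> v \<le> (sigma_max T)\<^sup>2 * (v \<bullet> (N *\<^sub>v v))"
      using Nform[OF v] v
        transpose_mult_mat_vec_le[OF T(1) _ mult_mat_vec_le_sigma_max[OF T(1) _ n] Uv]
      by simp
    have "(U *\<^sub>v w) \<bullet> (U *\<^sub>v w) \<le> 1 / (sigma_min T)\<^sup>2 * (w \<bullet> w)" if w: "w \<in> carrier_vec n" for w
    proof -
      have "T *\<^sub>v (U *\<^sub>v w) = w"
        using assoc_mult_mat_vec[OF T(1) U(1) w] U(2) w by simp
      then have "(sigma_min T)\<^sup>2 * ((U *\<^sub>v w) \<bullet> (U *\<^sub>v w)) \<le> w \<bullet> w"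
        using sigma_min_le_mult_mat_vec[OF T(1) _ n, of "U *\<^sub>v w"] U w by simp
      then show ?thesis using sigma_min_sq_pos[OF T n] by (simp add: field_simps)
    qed
    then show "v \<bullet> (N *\<^sub>v v) \<le> 1 / (sigma_min T)\<^sup>2 * (v \<bullet> v)"
      unfolding Nform[OF v] by (intro transpose_mult_mat_vec_le[OF U(1)] v) auto
  qed simp
  then show ?thesis by (simp add: alpha_const_def s_def C_def U_def)
qed

section \<open>The finite family of actuator subsets\<close>

lemma input_mat_carrier:
  assumes "distinct bs" "S \<subseteq> set bs"
  shows "input_mat n bs S \<in> carrier_mat n (card S)"
proof -
  \<comment> \<open>Distinctness of \<open>bs\<close> makes the number of columns the cardinality of
    \<open>S\<close>, matching the size of \<open>R S\<close>.\<close>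
  have "length (filter (\<lambda>b. b \<in> S) bs) = card (set (filter (\<lambda>b. b \<in> S) bs))"
    using assms(1) by (intro distinct_card[symmetric]) simp
  also have "set (filter (\<lambda>b. b \<in> S) bs) = S" using assms(2) by auto
  finally show ?thesis unfolding input_mat_def by (metis mat_of_cols_carrier(1))
qed

lemma influence_mat_le_lambda_max_influence:
  assumes n: "0 < n" and bs: "distinct bs" and S: "S \<subseteq> set bs" "card S \<le> k"
    and R: "pos_def (card S) (R S)"
  shows "0 \<le> lambda_max_influence n bs R k"
    and "w \<in> carrier_vec n \<Longrightarrow>
      w \<bullet> (influence_mat n bs R S *\<^sub>v w) \<le> lambda_max_influence n bs R k * (w \<bullet> w)"
proof -
  have psd: "pos_semidef n (influence_mat n bs R S)"
    unfolding influence_mat_def using pos_semidef_influence[OF R input_mat_carrier[OF bs S(1)]] .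
  then have sym: "symmetric_mat n (influence_mat n bs R S)" by (simp add: pos_semidef_def)
  \<comment> \<open>The family is contained in an image of a finite power set, so the
    \<open>Max\<close> in \<open>lambda_max_influence\<close> is a true upper bound; its sign comes
    from the semidefinite member given by \<open>S\<close>.\<close>
  have "influence_mats n bs R k \<subseteq> influence_mat n bs R ` Pow (set bs)"
    by (auto simp: influence_mats_def)
  then have "finite (influence_mats n bs R k)" by (rule finite_subset) simp
  moreover have "influence_mat n bs R S \<in> influence_mats n bs R k"
    using S by (auto simp: influence_mats_def)
  ultimately have le: "lambda_max (influence_mat n bs R S) \<le> lambda_max_influence n bs R k"
    unfolding lambda_max_influence_def by (intro Max_ge) auto
  then show "0 \<le> lambda_max_influence n bs R k"
    using pos_semidef_spectrum_nonneg[OF psd lambda_max_in_spectrum[OF sym n]] by simp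
  assume "w \<in> carrier_vec n"
  from quadratic_form_le_lambda_max[OF sym this n]
  show "w \<bullet> (influence_mat n bs R S *\<^sub>v w) \<le> lambda_max_influence n bs R k * (w \<bullet> w)"
    using mult_right_mono[OF le scalar_prod_self_nonneg[of w]] by simp
qed

lemma mat_trace_pos_def_pos:
  assumes "pos_def n Q" "0 < n"
  shows "0 < mat_trace Q"
proof -
  have Q: "Q \<in> carrier_mat n n" using assms by (simp add: pos_def_def symmetric_mat_def)
  show ?thesis
    unfolding mat_trace_quadratic_form[OF Q]
  proof (rule sum_pos)
    fix i assume "i \<in> {..<n}"
    then have "unit_vec n i \<noteq> (0\<^sub>v n :: real vec)" by auto
    then show "0 < unit_vec n i \<bullet> (Q *\<^sub>v unit_vec n i)"
      using assms(1) unit_vec_carrier unfolding pos_def_def by blast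
  qed (use assms in auto)
qed

theorem theorem2:
  fixes n k :: nat
    and A Q T P_opt P_worst :: "real mat"
    and bs :: "real vec list"
    and R :: "real vec set \<Rightarrow> real mat"
  assumes n_pos: "1 \<le> n"
    and A_dim: "A \<in> carrier_mat n n"
    and A_inv: "invertible_mat A"
    and A_stable: "schur_stable A"
    and bs_dim: "set bs \<subseteq> carrier_vec n"
    and bs_distinct: "distinct bs"
    and k_bounds: "1 \<le> k" "k \<le> length bs"
    and R_pos_def: "\<And>S. S \<subseteq> set bs \<Longrightarrow> pos_def (card S) (R S)"
    and Q_pos_def: "pos_def n Q"
    and T_dim: "T \<in> carrier_mat n n"
    and T_inv: "invertible_mat T"
    and T_contr: "sigma_max (T * A * mat_inv T) < 1"
    and P_opt: "best_cost_mat n A Q bs R k P_opt"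
    and P_worst: "worst_cost_mat n A Q bs R k P_worst"
  shows "mat_trace P_worst / mat_trace P_opt
    \<le> alpha_const A T * (1 + lambda_max_influence n bs R k * lambda_min Q) * mat_trace Q
       / ((sigma_min A)\<^sup>2 * lambda_min Q
          + (1 + lambda_max_influence n bs R k * lambda_min Q) * mat_trace Q)"
proof -
  have n: "0 < n" using n_pos by simp
  have detT: "det T \<noteq> 0" using invertible_mat_det_nonzero[OF T_dim T_inv] .
  have tQ: "0 < mat_trace Q" using mat_trace_pos_def_pos[OF Q_pos_def n] .
  define l where "l = lambda_min Q"
  define r where "r = lambda_max_influence n bs R k"
  define g where "g = (sigma_min A)\<^sup>2 * l"
  obtain Sw where Sw: "Sw \<subseteq> set bs" "lqr_cost_mat n A Q bs R Sw P_worst"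
    using P_worst by (auto simp: worst_cost_mat_def)
  obtain So where So: "So \<subseteq> set bs" "card So = k" "lqr_cost_mat n A Q bs R So P_opt"
    using P_opt by (auto simp: best_cost_mat_def)
  have Bw: "input_mat n bs Sw \<in> carrier_mat n (card Sw)"
    and Bo: "input_mat n bs So \<in> carrier_mat n (card So)"
    using input_mat_carrier bs_distinct Sw So by auto
  have upper: "mat_trace P_worst \<le> alpha_const A T * mat_trace Q"
    using Sw riccati_cost_trace_upper[OF n A_dim pos_def_imp_pos_semidef[OF Q_pos_def] _
        R_pos_def[OF Sw(1)] Bw _ T_dim detT T_contr]
    by (simp add: lqr_cost_mat_def)
  \<comment> \<open>\<open>card So = k\<close> places \<open>So\<close> in the family of subsets
    with at most \<open>k\<close> elements, which brings its influence form below
    \<open>r\<close>.\<close>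
  note influence = influence_mat_le_lambda_max_influence[where R = R,
      OF n bs_distinct So(1) eq_imp_le[OF So(2)] R_pos_def[OF So(1)], folded r_def]
  have r: "0 \<le> r" using influence(1) .
  have l: "0 < l" using lambda_min_pos[OF Q_pos_def n] by (simp add: l_def)
  have rl: "0 < 1 + r * l" using r l by (simp add: add_pos_nonneg)
  have lower: "mat_trace Q + g / (1 + r * l) \<le> mat_trace P_opt"
    unfolding g_def l_def
    using So influence(2)
    by (intro riccati_cost_trace_lower[OF n A_dim Q_pos_def _ R_pos_def[OF So(1)] Bo r])
      (auto simp: lqr_cost_mat_def influence_mat_def)
  have g: "0 \<le> g" using l by (simp add: g_def)
  \<comment> \<open>The sign makes the numerator bound nonnegative, as monotonicity of the quotient
    in its denominator demands; it follows from the contraction hypothesis.\<close>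
  have "0 \<le> alpha_const A T"
  proof -
    have "T * A * mat_inv T \<in> carrier_mat n n"
      using mat_inv_correct(1)[OF T_dim detT] T_dim A_dim by simp
    then have "(sigma_max (T * A * mat_inv T))\<^sup>2 < 1"
      using sigma_max_sq(1)[OF _ n] T_contr by (simp add: power_less_one_iff)
    then show ?thesis by (simp add: alpha_const_def)
  qed
  then have aQ: "0 \<le> alpha_const A T * mat_trace Q" using tQ by simp
  have "mat_trace P_worst / mat_trace P_opt
      \<le> alpha_const A T * mat_trace Q / (mat_trace Q + g / (1 + r * l))"
    using upper lower aQ tQ g rl by (intro frac_le) (auto simp: add_pos_nonneg)
  also have "\<dots> = alpha_const A T * (1 + r * l) * mat_trace Q / (g + (1 + r * l) * mat_trace Q)"
  proof -
    \<comment> \<open>Clearing the inner fraction moves the factor \<open>1 + r * l\<close> into the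
      numerator of the ratio.\<close>
    have "mat_trace Q + g / (1 + r * l) = (g + (1 + r * l) * mat_trace Q) / (1 + r * l)"
      using rl by (simp add: field_simps)
    then show ?thesis by (simp add: mult_ac)
  qed
  finally show ?thesis by (simp only: g_def l_def r_def)
qed

end
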